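(* One can universally quantify a set of literals from an SDD circuit in time linear in the circuit size, with the result being an NNF circuit. That is, there is an algorithm that, given an SDD circuit $\Delta$ and a set of literals $\{\ell_1,\ldots,\ell_n\}$, outputs in time linear in the size of $\Delta$ an NNF circuit that is logically equivalent to $\forall \ell_1,\ldots,\ell_n\cdot\Delta$.
   Context: An NNF circuit is a Boolean circuit (rooted directed acyclic graph) whose leaves are labelled with constants true/false or literals ($x$ or $\bar{x}$ for a Boolean variable $X$) and whose internal nodes are and-nodes or or-nodes; its size is the size of this graph. An NNF circuit is decomposable if for every and-node the sets of variables of its children are pairwise disjoint. An SDD circuit (sentential decision diagram) is an NNF circuit which is a constant, a literal, or is composed of fragments of the form $(p_1\wedge s_1)\vee\cdots\vee(p_k\wedge s_k)$, where the $p_i$ (primes) and $s_i$ (subs) are again constants, literals or such fragments, such that: the circuit is decomposable (in fact structured decomposable: there is a full binary tree whose leaves are the variables, such that for every conjunction $p_i\wedge s_i$ some tree node has the variables of $p_i$ in its left subtree and those of $s_i$ in its right subtree); and in each fragment the primes form a partition, i.e. each $p_i$ is consistent, $p_i\wedge p_j$ is inconsistent for $i\neq j$, and $p_1\vee\cdots\vee p_k$ is valid. Conditioning: $\varphi|x$ (resp. $\varphi|\bar{x}$) is obtained by replacing every occurrence of variable $X$ in $\varphi$ with true (resp. false). Universal literal quantification is $\forall \ell\cdot\varphi = (\ell\vee(\varphi|\bar{\ell}))\wedge(\varphi|\ell)$ (with $\bar{\ell}$ the complement of $\ell$); several literals are quantified successively (the order does not matter up to logical equivalence). *)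

theory Defs
  imports Main
begin

datatype literal = Pos nat | Neg nat

fun var :: "literal \<Rightarrow> nat" where
  "var (Pos x) = x"
| "var (Neg x) = x"

fun compl :: "literal \<Rightarrow> literal" where
  "compl (Pos x) = Neg x"
| "compl (Neg x) = Pos x"

datatype formula =
    FConst bool
  | FLit literal
  | FAnd "formula list"
  | FOr "formula list"

fun eval_literal :: "(nat \<Rightarrow> bool) \<Rightarrow> literal \<Rightarrow> bool" where
  "eval_literal \<sigma> (Pos x) = \<sigma> x"
| "eval_literal \<sigma> (Neg x) = (\<not> \<sigma> x)"

fun eval :: "(nat \<Rightarrow> bool) \<Rightarrow> formula \<Rightarrow> bool" where
  "eval \<sigma> (FConst b) = b"
| "eval \<sigma> (FLit l) = eval_literal \<sigma> l"
| "eval \<sigma> (FAnd fs) = (\<forall>f \<in> set fs. eval \<sigma> f)"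
| "eval \<sigma> (FOr fs) = (\<exists>f \<in> set fs. eval \<sigma> f)"

fun vars :: "formula \<Rightarrow> nat set" where
  "vars (FConst b) = {}"
| "vars (FLit l) = {var l}"
| "vars (FAnd fs) = (\<Union>f \<in> set fs. vars f)"
| "vars (FOr fs) = (\<Union>f \<in> set fs. vars f)"

definition consistent :: "formula \<Rightarrow> bool" where
  "consistent \<phi> \<longleftrightarrow> (\<exists>\<sigma>. eval \<sigma> \<phi>)"

definition valid :: "formula \<Rightarrow> bool" where
  "valid \<phi> \<longleftrightarrow> (\<forall>\<sigma>. eval \<sigma> \<phi>)"

definition equivalent :: "formula \<Rightarrow> formula \<Rightarrow> bool" where
  "equivalent \<phi> \<psi> \<longleftrightarrow> (\<forall>\<sigma>. eval \<sigma> \<phi> = eval \<sigma> \<psi>)"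

fun subst_var :: "nat \<Rightarrow> bool \<Rightarrow> formula \<Rightarrow> formula" where
  "subst_var x b (FConst c) = FConst c"
| "subst_var x b (FLit (Pos y)) = (if y = x then FConst b else FLit (Pos y))"
| "subst_var x b (FLit (Neg y)) = (if y = x then FConst (\<not> b) else FLit (Neg y))"
| "subst_var x b (FAnd fs) = FAnd (map (subst_var x b) fs)"
| "subst_var x b (FOr fs) = FOr (map (subst_var x b) fs)"

fun condition :: "formula \<Rightarrow> literal \<Rightarrow> formula" where
  "condition \<phi> (Pos x) = subst_var x True \<phi>"
| "condition \<phi> (Neg x) = subst_var x False \<phi>"

definition forall_literal :: "literal \<Rightarrow> formula \<Rightarrow> formula" where
  "forall_literal l \<phi> = FAnd [FOr [FLit l, condition \<phi> (compl l)], condition \<phi> l]"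

definition forall_literals :: "literal list \<Rightarrow> formula \<Rightarrow> formula" where
  "forall_literals ls \<phi> = foldr forall_literal ls \<phi>"

text \<open>
  The nodes of a circuit are the positions in its list of gates; \<open>And\<close> and \<open>Or\<close> gates carry
  the list of their children. The numbering need not be a topological order.
\<close>

datatype gate =
    Const bool
  | Lit literal
  | And "nat list"
  | Or "nat list"

datatype circuit = Circuit (gates: "gate list") (root: nat)

fun children :: "gate \<Rightarrow> nat list" where
  "children (Const b) = []"
| "children (Lit l) = []"
| "children (And cs) = cs"
| "children (Or cs) = cs"

definition edges :: "circuit \<Rightarrow> (nat \<times> nat) set" where
  "edges C = {(i, j). i < length (gates C) \<and> j \<in> set (children (gates C ! i))}"

fun is_leaf :: "gate \<Rightarrow> bool" where
  "is_leaf (Const b) = True"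
| "is_leaf (Lit l) = True"
| "is_leaf (And cs) = False"
| "is_leaf (Or cs) = False"

definition nnf_circuit :: "circuit \<Rightarrow> bool" where
  "nnf_circuit C \<longleftrightarrow>
     root C < length (gates C) \<and>
     (\<forall>(i, j) \<in> edges C. j < length (gates C)) \<and>
     acyclic (edges C) \<and>
     (\<forall>i < length (gates C). (root C, i) \<in> (edges C)\<^sup>*) \<and>
     (\<forall>i < length (gates C). \<not> is_leaf (gates C ! i) \<longrightarrow> children (gates C ! i) \<noteq> [])"

definition circuit_size :: "circuit \<Rightarrow> nat" where
  "circuit_size C = length (gates C) + (\<Sum>g\<leftarrow>gates C. length (children g))"

lemma finite_edges: "finite (edges C)"
proof -
  have "edges C \<subseteq> (\<Union>i < length (gates C). {i} \<times> set (children (gates C ! i)))"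
    by (auto simp: edges_def)
  then show ?thesis
    by (rule finite_subset) auto
qed

text \<open>
  The formula obtained by unfolding the circuit below a node; the \<open>else\<close> branch is
  only taken for graphs or nodes that are not part of any circuit.
\<close>

function formula_at :: "circuit \<Rightarrow> nat \<Rightarrow> formula" where
  "formula_at C i =
     (if acyclic (edges C) \<and> i < length (gates C) then
        (case gates C ! i of
           Const b \<Rightarrow> FConst b
         | Lit l \<Rightarrow> FLit l
         | And cs \<Rightarrow> FAnd (map (formula_at C) cs)
         | Or cs \<Rightarrow> FOr (map (formula_at C) cs))
      else FConst False)"
  by pat_completeness auto
termination
proof (relation "same_fst (\<lambda>C. acyclic (edges C)) (\<lambda>C. (edges C)\<inverse>)")
  show "wf (same_fst (\<lambda>C. acyclic (edges C)) (\<lambda>C. (edges C)\<inverse>))"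
    by (intro wf_same_fst finite_acyclic_wf_converse finite_edges)
qed (auto simp: same_fst_def edges_def)

declare formula_at.simps [simp del]

definition formula_of :: "circuit \<Rightarrow> formula" where
  "formula_of C = formula_at C (root C)"

definition decomposable :: "circuit \<Rightarrow> bool" where
  "decomposable C \<longleftrightarrow>
     (\<forall>i < length (gates C). \<forall>cs. gates C ! i = And cs \<longrightarrow>
        (\<forall>j < length cs. \<forall>k < length cs. j \<noteq> k \<longrightarrow>
           vars (formula_at C (cs ! j)) \<inter> vars (formula_at C (cs ! k)) = {}))"

datatype vtree = Leaf nat | Node vtree vtree

fun leaves :: "vtree \<Rightarrow> nat list" where
  "leaves (Leaf x) = [x]"
| "leaves (Node l r) = leaves l @ leaves r"

fun subtrees :: "vtree \<Rightarrow> vtree set" where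
  "subtrees (Leaf x) = {Leaf x}"
| "subtrees (Node l r) = insert (Node l r) (subtrees l \<union> subtrees r)"

definition splits :: "vtree \<Rightarrow> formula \<Rightarrow> formula \<Rightarrow> bool" where
  "splits T \<phi> \<psi> \<longleftrightarrow>
     (\<exists>l r. Node l r \<in> subtrees T \<and> vars \<phi> \<subseteq> set (leaves l) \<and> vars \<psi> \<subseteq> set (leaves r))"

definition partition_formulas :: "formula list \<Rightarrow> bool" where
  "partition_formulas \<phi>s \<longleftrightarrow>
     (\<forall>\<phi> \<in> set \<phi>s. consistent \<phi>) \<and>
     (\<forall>i < length \<phi>s. \<forall>j < length \<phi>s. i \<noteq> j \<longrightarrow> \<not> consistent (FAnd [\<phi>s ! i, \<phi>s ! j])) \<and>
     valid (FOr \<phi>s)"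

text \<open>In a fragment, \<open>els\<close> lists the pairs of (nodes of) primes and subs.\<close>

inductive sdd_node :: "circuit \<Rightarrow> vtree \<Rightarrow> nat \<Rightarrow> bool" for C :: circuit and T :: vtree where
  const: "gates C ! i = Const b \<Longrightarrow> sdd_node C T i"
| lit: "gates C ! i = Lit l \<Longrightarrow> sdd_node C T i"
| fragment:
    "\<lbrakk>gates C ! i = Or cs;
      list_all2 (\<lambda>c (p, s). gates C ! c = And [p, s]) cs els;
      \<And>p s. (p, s) \<in> set els \<Longrightarrow> sdd_node C T p;
      \<And>p s. (p, s) \<in> set els \<Longrightarrow> sdd_node C T s;
      \<And>p s. (p, s) \<in> set els \<Longrightarrow> splits T (formula_at C p) (formula_at C s);
      partition_formulas (map (\<lambda>(p, s). formula_at C p) els)\<rbrakk>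
     \<Longrightarrow> sdd_node C T i"

definition sdd_circuit :: "circuit \<Rightarrow> bool" where
  "sdd_circuit C \<longleftrightarrow>
     nnf_circuit C \<and> decomposable C \<and>
     (\<exists>T. distinct (leaves T) \<and> vars (formula_of C) \<subseteq> set (leaves T) \<and> sdd_node C T (root C))"

text \<open>
  Algorithms are programs of a random access machine with unit costs: finitely many registers
  and finitely many unbounded arrays of natural numbers, the only arithmetic being the successor.
  Hence after \<open>t\<close> steps no stored number exceeds the largest number in the input or in the
  program by more than \<open>t\<close>, so unit costs cannot be exploited by computing with huge numbers.
\<close>

datatype state = State (reg: "nat \<Rightarrow> nat") (arr: "nat \<Rightarrow> nat \<Rightarrow> nat")

datatype test = Less nat nat | Equal nat nat

datatype program =
    SetConst nat nat
  | Copy nat nat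
  | Succ nat nat
  | Read nat nat nat
  | Write nat nat nat
  | Seq program program
  | If test program program
  | While test program

definition set_reg :: "nat \<Rightarrow> nat \<Rightarrow> state \<Rightarrow> state" where
  "set_reg r v s = State ((reg s)(r := v)) (arr s)"

definition set_arr :: "nat \<Rightarrow> nat \<Rightarrow> nat \<Rightarrow> state \<Rightarrow> state" where
  "set_arr a k v s = State (reg s) ((arr s)(a := (arr s a)(k := v)))"

fun holds :: "test \<Rightarrow> state \<Rightarrow> bool" where
  "holds (Less r q) s = (reg s r < reg s q)"
| "holds (Equal r q) s = (reg s r = reg s q)"

text \<open>\<open>exec P s t s'\<close>: started in \<open>s\<close>, the program \<open>P\<close> halts after \<open>t\<close> steps in \<open>s'\<close>.\<close>

inductive exec :: "program \<Rightarrow> state \<Rightarrow> nat \<Rightarrow> state \<Rightarrow> bool" where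
  set_const: "exec (SetConst r n) s 1 (set_reg r n s)"
| copy: "exec (Copy r q) s 1 (set_reg r (reg s q) s)"
| succ: "exec (Succ r q) s 1 (set_reg r (reg s q + 1) s)"
| read_arr: "exec (Read r a q) s 1 (set_reg r (arr s a (reg s q)) s)"
| write_arr: "exec (Write a q r) s 1 (set_arr a (reg s q) (reg s r) s)"
| seq: "\<lbrakk>exec P s t s'; exec Q s' u s''\<rbrakk> \<Longrightarrow> exec (Seq P Q) s (t + u) s''"
| if_true: "\<lbrakk>holds b s; exec P s t s'\<rbrakk> \<Longrightarrow> exec (If b P Q) s (1 + t) s'"
| if_false: "\<lbrakk>\<not> holds b s; exec Q s t s'\<rbrakk> \<Longrightarrow> exec (If b P Q) s (1 + t) s'"
| while_false: "\<not> holds b s \<Longrightarrow> exec (While b P) s 1 s"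
| while_true: "\<lbrakk>holds b s; exec P s t s'; exec (While b P) s' u s''\<rbrakk>
    \<Longrightarrow> exec (While b P) s (1 + t + u) s''"

inductive_cases exec_SetConstE: "exec (SetConst r n) s t s'"
inductive_cases exec_CopyE: "exec (Copy r q) s t s'"
inductive_cases exec_SuccE: "exec (Succ r q) s t s'"
inductive_cases exec_ReadE: "exec (Read r a q) s t s'"
inductive_cases exec_WriteE: "exec (Write a q r) s t s'"
inductive_cases exec_SeqE: "exec (Seq P Q) s t s'"
inductive_cases exec_IfE: "exec (If b P Q) s t s'"
inductive_cases exec_WhileE: "exec (While b P) s t s'"

lemma exec_deterministic:
  "exec P s t s' \<Longrightarrow> exec P s u s'' \<Longrightarrow> u = t \<and> s'' = s'"
proof (induction arbitrary: u s'' rule: exec.induct)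
  case (set_const r n s)
  then show ?case by (rule exec_SetConstE) simp
next
  case (copy r q s)
  then show ?case by (rule exec_CopyE) simp
next
  case (succ r q s)
  then show ?case by (rule exec_SuccE) simp
next
  case (read_arr r a q s)
  then show ?case by (rule exec_ReadE) simp
next
  case (write_arr a q r s)
  then show ?case by (rule exec_WriteE) simp
next
  case (seq P s t s' Q t' s1)
  from seq.prems show ?case
  proof (rule exec_SeqE)
    fix v s2 w
    assume "u = v + w" "exec P s v s2" "exec Q s2 w s''"
    with seq.IH(1)[of v s2] seq.IH(2)[of w s''] show ?thesis by simp
  qed
next
  case (if_true b s P t s' Q)
  from if_true.prems show ?case
  proof (rule exec_IfE)
    fix v
    assume "u = Suc v" "exec P s v s''"
    with if_true.IH[of v s''] show ?thesis by simp
  qed (use if_true.hyps in simp_all)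
next
  case (if_false b s Q t s' P)
  from if_false.prems show ?case
  proof (rule exec_IfE)
    fix v
    assume "u = Suc v" "exec Q s v s''"
    with if_false.IH[of v s''] show ?thesis by simp
  qed (use if_false.hyps in simp_all)
next
  case (while_false b s P)
  from while_false.prems show ?case
    by (rule exec_WhileE) (use while_false.hyps in simp_all)
next
  case (while_true b s P t s' t' s1)
  from while_true.prems show ?case
  proof (rule exec_WhileE)
    fix v s2 w
    assume "u = Suc (v + w)" "exec P s v s2" "exec (While b P) s2 w s''"
    with while_true.IH(1)[of v s2] while_true.IH(2)[of w s''] show ?thesis by simp
  qed (use while_true.hyps in simp_all)
qed

text \<open>
  A circuit occupies the registers \<open>b\<close> (number of nodes), \<open>b + 1\<close> (root) and the arrays
  \<open>b\<close> (tag of each node), \<open>b + 1\<close> (variable, or where the children start), \<open>b + 2\<close> (where the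
  children end), \<open>b + 3\<close> (children).
\<close>

definition stores_children :: "nat \<Rightarrow> state \<Rightarrow> nat \<Rightarrow> nat list \<Rightarrow> bool" where
  "stores_children b s i cs \<longleftrightarrow>
     arr s (b + 2) i = arr s (b + 1) i + length cs \<and>
     (\<forall>k < length cs. arr s (b + 3) (arr s (b + 1) i + k) = cs ! k)"

fun stores_gate :: "nat \<Rightarrow> state \<Rightarrow> nat \<Rightarrow> gate \<Rightarrow> bool" where
  "stores_gate b s i (Const v) \<longleftrightarrow> arr s b i = (if v then 1 else 0)"
| "stores_gate b s i (Lit (Pos x)) \<longleftrightarrow> arr s b i = 2 \<and> arr s (b + 1) i = x"
| "stores_gate b s i (Lit (Neg x)) \<longleftrightarrow> arr s b i = 3 \<and> arr s (b + 1) i = x"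
| "stores_gate b s i (And cs) \<longleftrightarrow> arr s b i = 4 \<and> stores_children b s i cs"
| "stores_gate b s i (Or cs) \<longleftrightarrow> arr s b i = 5 \<and> stores_children b s i cs"

definition stores_circuit :: "nat \<Rightarrow> state \<Rightarrow> circuit \<Rightarrow> bool" where
  "stores_circuit b s C \<longleftrightarrow>
     reg s b = length (gates C) \<and> reg s (b + 1) = root C \<and>
     (\<forall>i < length (gates C). stores_gate b s i (gates C ! i))"

text \<open>
  Two representations of the set of literals. With a list, an algorithm must at least read the
  literals, also those whose variable does not occur in the circuit. With a table of
  characteristic bits (arrays \<open>b\<close> and \<open>b + 1\<close> for positive and negative literals), the running
  time need not depend on the set at all. Registers and arrays not mentioned are unconstrained.
\<close>

definition stores_literal_list :: "nat \<Rightarrow> state \<Rightarrow> literal list \<Rightarrow> bool" where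
  "stores_literal_list b s ls \<longleftrightarrow>
     reg s b = length ls \<and>
     (\<forall>k < length ls. arr s b k = var (ls ! k) \<and>
        arr s (b + 1) k = (if ls ! k = Pos (var (ls ! k)) then 1 else 0))"

definition stores_literal_table :: "nat \<Rightarrow> state \<Rightarrow> literal set \<Rightarrow> bool" where
  "stores_literal_table b s L \<longleftrightarrow>
     (\<forall>x. arr s b x = (if Pos x \<in> L then 1 else 0) \<and>
          arr s (b + 1) x = (if Neg x \<in> L then 1 else 0))"

definition outputs_forall ::
  "program \<Rightarrow> state \<Rightarrow> nat \<Rightarrow> literal list \<Rightarrow> circuit \<Rightarrow> bool" where
  "outputs_forall P s t ls C \<longleftrightarrow>
     (\<exists>u s' D. exec P s u s' \<and> u \<le> t \<and> stores_circuit 8 s' D \<and> nnf_circuit D \<and>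
        equivalent (formula_of D) (forall_literals ls (formula_of C)))"

end

theory Submission imports Defs begin

text \<open>
  Universal quantification distributes over conjunctions, and over disjunctions of formulas without
  common variables. As exactly one prime of a fragment holds, the fragment
  $\bigvee_i (p_i \wedge s_i)$ is equivalent to $\bigwedge_i (\neg p_i \vee s_i)$ and its negation
  to $\bigwedge_i (\neg p_i \vee \neg s_i)$, and decomposability separates the variables of $p_i$
  and $s_i$. So it suffices to compute two copies of every node, quantifying the node and its
  negation, which is possible locally: only gates and the indices of children change.
\<close>

text \<open>Quantifying the literals in L makes \<phi> hold at \<sigma> iff \<phi> holds at every
  assignment in \<open>flips L \<sigma>\<close>, obtained from \<sigma> by making some literals of L
  true. These assignments form a product over the variables, so two counterexamples that concern
  disjoint variables can be merged into one; this is the whole reason for the distribution law for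
  disjunctions. The obstacle is that different terms of a fragment may share variables, so the law
  does not apply to the fragment's own disjunction. In the conjunctive form the only disjunctions
  left are those between a prime and its sub. Negated primes then have to be quantified, and since
  quantification does not commute with negation, this needs a value computed separately. The
  transformation is not De Morgan's: fragments become conjunctions of clauses for both polarities,
  and the prime is negated in both. Hence the copies of an and-gate do not represent the quantified
  and-gate or its negation, and correctness is stated only for constants, literals and
  fragments.\<close>

section \<open>Semantics of universal literal quantification\<close>

definition flips :: "literal set \<Rightarrow> (nat \<Rightarrow> bool) \<Rightarrow> (nat \<Rightarrow> bool) set" where
  "flips L \<sigma> = {\<tau>. \<forall>x. \<tau> x \<noteq> \<sigma> x \<longrightarrow> (if \<tau> x then Pos x else Neg x) \<in> L}"

fun satisfying :: "literal \<Rightarrow> (nat \<Rightarrow> bool) \<Rightarrow> nat \<Rightarrow> bool" where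
  "satisfying (Pos x) \<sigma> = \<sigma>(x := True)"
| "satisfying (Neg x) \<sigma> = \<sigma>(x := False)"

lemma eval_subst_var: "eval \<sigma> (subst_var x b \<phi>) = eval (\<sigma>(x := b)) \<phi>"
  by (induction x b \<phi> rule: subst_var.induct) auto

lemma eval_cong: "(\<And>x. x \<in> vars \<phi> \<Longrightarrow> \<sigma> x = \<tau> x) \<Longrightarrow> eval \<sigma> \<phi> = eval \<tau> \<phi>"
proof (induction \<phi>)
  case (FLit l)
  then show ?case by (cases l) auto
next
  case (FAnd fs)
  have "eval \<sigma> f = eval \<tau> f" if "f \<in> set fs" for f
    using that FAnd.prems by (intro FAnd.IH) auto
  then show ?case by simp
next
  case (FOr fs)
  have "eval \<sigma> f = eval \<tau> f" if "f \<in> set fs" for f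
    using that FOr.prems by (intro FOr.IH) auto
  then show ?case by simp
qed simp

text \<open>If \<sigma> satisfies l, the first conjunct holds trivially and conditioning on l
  changes nothing. Otherwise conditioning on the complement changes nothing, and conditioning on l
  moves to the other assignment.\<close>

lemma eval_forall_literal:
  "eval \<sigma> (forall_literal l \<phi>) \<longleftrightarrow> eval \<sigma> \<phi> \<and> eval (satisfying l \<sigma>) \<phi>"
proof -
  have "\<sigma>(x := \<sigma> x) = \<sigma>" for x by simp
  then show ?thesis
    by (cases l; cases "\<sigma> (var l)")
      (auto simp: forall_literal_def eval_subst_var fun_upd_idem)
qed

lemma flips_empty: "flips {} \<sigma> = {\<sigma>}"
  by (auto simp: flips_def)

lemma flips_refl: "\<sigma> \<in> flips L \<sigma>"
  by (simp add: flips_def)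

text \<open>An assignment that satisfies l may as well be reached by satisfying l before the other
  changes; one that falsifies l cannot have used l. The argument also covers the complement of l
  being in L.\<close>

lemma flips_insert: "flips (insert l L) \<sigma> = flips L \<sigma> \<union> flips L (satisfying l \<sigma>)"
proof (intro set_eqI iffI)
  fix \<tau> assume "\<tau> \<in> flips L \<sigma> \<union> flips L (satisfying l \<sigma>)"
  then show "\<tau> \<in> flips (insert l L) \<sigma>"
    by (cases l) (auto simp: flips_def split: if_splits)
next
  fix \<tau> assume \<tau>: "\<tau> \<in> flips (insert l L) \<sigma>"
  show "\<tau> \<in> flips L \<sigma> \<union> flips L (satisfying l \<sigma>)"
  proof (cases "eval_literal \<tau> l")
    case True
    with \<tau> have "\<tau> \<in> flips L (satisfying l \<sigma>)"
      by (cases l) (auto simp: flips_def split: if_splits)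
    then show ?thesis ..
  next
    case False
    with \<tau> have "\<tau> \<in> flips L \<sigma>"
      by (cases l) (auto simp: flips_def split: if_splits)
    then show ?thesis ..
  qed
qed

lemma eval_forall_literals:
  "eval \<sigma> (forall_literals ls \<phi>) \<longleftrightarrow> (\<forall>\<tau>\<in>flips (set ls) \<sigma>. eval \<tau> \<phi>)"
proof (induction ls arbitrary: \<sigma>)
  case Nil
  then show ?case by (simp add: forall_literals_def flips_empty)
next
  case (Cons l ls)
  have "forall_literals (l # ls) \<phi> = forall_literal l (forall_literals ls \<phi>)"
    by (simp add: forall_literals_def)
  then show ?case
    by (simp add: eval_forall_literal Cons flips_insert ball_Un)
qed

lemma forall_flips_disj:
  assumes "vars \<phi> \<inter> vars \<psi> = {}"
  shows "(\<forall>\<tau>\<in>flips L \<sigma>. eval \<tau> \<phi> = a \<or> eval \<tau> \<psi> = b) \<longleftrightarrow>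
    (\<forall>\<tau>\<in>flips L \<sigma>. eval \<tau> \<phi> = a) \<or> (\<forall>\<tau>\<in>flips L \<sigma>. eval \<tau> \<psi> = b)"
proof (rule ccontr)
  assume contr: "\<not> ?thesis"
  then obtain \<tau>1 \<tau>2 where \<tau>: "\<tau>1 \<in> flips L \<sigma>" "eval \<tau>1 \<phi> \<noteq> a" "\<tau>2 \<in> flips L \<sigma>" "eval \<tau>2 \<psi> \<noteq> b"
    and all: "\<forall>\<tau>\<in>flips L \<sigma>. eval \<tau> \<phi> = a \<or> eval \<tau> \<psi> = b"
    by blast
  \<comment> \<open>Membership in \<open>flips\<close> is a condition on each variable separately,
    so the merged counterexample is again admissible.\<close>
  define \<tau> where "\<tau> = (\<lambda>x. if x \<in> vars \<phi> then \<tau>1 x else \<tau>2 x)"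
  have "\<tau> \<in> flips L \<sigma>" using \<tau> by (auto simp: \<tau>_def flips_def)
  moreover have "eval \<tau> \<phi> = eval \<tau>1 \<phi>" by (rule eval_cong) (simp add: \<tau>_def)
  moreover have "eval \<tau> \<psi> = eval \<tau>2 \<psi>" by (rule eval_cong) (use assms in \<open>auto simp: \<tau>_def\<close>)
  ultimately show False using all \<tau> by blast
qed

text \<open>A literal that holds at \<sigma> can be lost only by a change that makes its complement
  true. This is why \<open>quant_gate\<close> replaces some literals by false.\<close>

lemma forall_flips_literal:
  "(\<forall>\<tau>\<in>flips L \<sigma>. eval_literal \<tau> l) \<longleftrightarrow> compl l \<notin> L \<and> eval_literal \<sigma> l"
proof
  assume all: "\<forall>\<tau>\<in>flips L \<sigma>. eval_literal \<tau> l"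
  then have l: "eval_literal \<sigma> l" using flips_refl by blast
  have "compl l \<notin> L"
  proof
    assume "compl l \<in> L"
    then have "satisfying (compl l) \<sigma> \<in> flips L \<sigma>"
      using l by (cases l) (auto simp: flips_def)
    with all have "eval_literal (satisfying (compl l) \<sigma>) l" by blast
    then show False by (cases l) auto
  qed
  with l show "compl l \<notin> L \<and> eval_literal \<sigma> l" by blast
next
  assume "compl l \<notin> L \<and> eval_literal \<sigma> l"
  then show "\<forall>\<tau>\<in>flips L \<sigma>. eval_literal \<tau> l"
    by (cases l) (auto simp: flips_def split: if_splits)
qed

lemma eval_literal_compl: "eval_literal \<sigma> (compl l) \<longleftrightarrow> \<not> eval_literal \<sigma> l"
  by (cases l) auto

lemma partition_formulas_unique:
  assumes "partition_formulas \<phi>s"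
  shows "\<exists>!i. i < length \<phi>s \<and> eval \<sigma> (\<phi>s ! i)"
proof -
  have "\<exists>i < length \<phi>s. eval \<sigma> (\<phi>s ! i)"
    using assms by (simp add: partition_formulas_def valid_def) (metis in_set_conv_nth)
  moreover have "i = j" if "i < length \<phi>s" "eval \<sigma> (\<phi>s ! i)" "j < length \<phi>s" "eval \<sigma> (\<phi>s ! j)" for i j
    using that assms by (auto simp: partition_formulas_def consistent_def)
  ultimately show ?thesis by blast
qed

section \<open>The quantified circuit\<close>

lemma eval_formula_at:
  assumes "acyclic (edges C)" "i < length (gates C)"
  shows "eval \<sigma> (formula_at C i) =
    (case gates C ! i of
       Const b \<Rightarrow> b
     | Lit l \<Rightarrow> eval_literal \<sigma> l
     | And cs \<Rightarrow> (\<forall>c\<in>set cs. eval \<sigma> (formula_at C c))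
     | Or cs \<Rightarrow> (\<exists>c\<in>set cs. eval \<sigma> (formula_at C c)))"
  using assms by (subst formula_at.simps) (simp split: gate.split)

text \<open>Copy \<open>True\<close> of a node computes the quantified node, copy \<open>False\<close> its quantified negation.\<close>

definition node_copy :: "nat \<Rightarrow> bool \<Rightarrow> nat \<Rightarrow> nat" where
  "node_copy n pol i = (if pol then i else n + i)"

definition signed :: "bool \<Rightarrow> literal \<Rightarrow> literal" where
  "signed pol l = (if pol then l else compl l)"

text \<open>The first child of an and-gate is the prime and is therefore always taken in its negated
  copy; only the sub follows the polarity. The image of \<open>And []\<close> is an arbitrary
  default, as circuits have no and-gate without children.\<close>

fun quant_gate :: "nat \<Rightarrow> literal set \<Rightarrow> bool \<Rightarrow> gate \<Rightarrow> gate" where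
  "quant_gate n L pol (Const b) = Const (b = pol)"
| "quant_gate n L pol (Lit l) =
     (if compl (signed pol l) \<in> L then Const False else Lit (signed pol l))"
| "quant_gate n L pol (And []) = Or []"
| "quant_gate n L pol (And (c # cs)) = Or (node_copy n False c # map (node_copy n pol) cs)"
| "quant_gate n L pol (Or cs) = And (map (node_copy n pol) cs)"

text \<open>
  The last two gates leave the function of the first copy of the root unchanged, by absorption,
  and make every node reachable.
\<close>

definition quant_circuit :: "literal set \<Rightarrow> circuit \<Rightarrow> circuit" where
  "quant_circuit L C =
     (let n = length (gates C) in
      Circuit
        (map (quant_gate n L True) (gates C) @ map (quant_gate n L False) (gates C) @
         [Or [0..<n + n], And [root C, n + n]])
        (Suc (n + n)))"

section \<open>Indices, edges and well-formedness of the quantified circuit\<close>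

lemma length_quant_circuit [simp]:
  "length (gates (quant_circuit L C)) = Suc (Suc (length (gates C) + length (gates C)))"
  by (simp add: quant_circuit_def Let_def)

lemma root_quant_circuit: "root (quant_circuit L C) = Suc (length (gates C) + length (gates C))"
  by (simp add: quant_circuit_def Let_def)

lemma quant_circuit_copy:
  "i < length (gates C) \<Longrightarrow>
    gates (quant_circuit L C) ! node_copy (length (gates C)) pol i =
    quant_gate (length (gates C)) L pol (gates C ! i)"
  by (auto simp: quant_circuit_def Let_def node_copy_def nth_append)

lemma quant_circuit_last:
  assumes "n = length (gates C)"
  shows "gates (quant_circuit L C) ! (n + n) = Or [0..<n + n]"
    and "gates (quant_circuit L C) ! Suc (n + n) = And [root C, n + n]"
  by (simp_all add: assms quant_circuit_def Let_def nth_append)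

lemma node_copy_less: "i < n \<Longrightarrow> node_copy n pol i < n + n"
  by (simp add: node_copy_def)

lemma node_copy_mod: "i < n \<Longrightarrow> node_copy n pol i mod n = i"
  by (simp add: node_copy_def)

lemma node_copy_cases:
  assumes "j < n + n"
  obtains pol i where "i < n" "j = node_copy n pol i"
proof (cases "j < n")
  case True
  then show thesis using that[of j True] by (simp add: node_copy_def)
next
  case False
  then show thesis using assms that[of "j - n" False] by (simp add: node_copy_def)
qed

lemma children_quant_gate:
  "set (children (quant_gate n L pol g)) \<subseteq> {node_copy n pol' c |pol' c. c \<in> set (children g)}"
  by (induction n L pol g rule: quant_gate.induct) auto

lemma children_quant_gate_nonempty:
  "\<not> is_leaf (quant_gate n L pol g) \<Longrightarrow> (\<not> is_leaf g \<longrightarrow> children g \<noteq> []) \<Longrightarrow>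
    children (quant_gate n L pol g) \<noteq> []"
  by (induction n L pol g rule: quant_gate.induct) (auto split: if_splits)

lemma quant_circuit_edge_cases:
  assumes C: "nnf_circuit C" and e: "(i, j) \<in> edges (quant_circuit L C)"
    and n: "n = length (gates C)"
  obtains pol i' pol' j' where
      "(i', j') \<in> edges C" "j' < n" "i' < n" "i = node_copy n pol i'" "j = node_copy n pol' j'"
    | "i = n + n" "j < n + n"
    | "i = Suc (n + n)" "j < Suc (n + n)"
proof -
  have i: "i < Suc (Suc (n + n))" and j: "j \<in> set (children (gates (quant_circuit L C) ! i))"
    using e by (simp_all add: edges_def n)
  have r: "root C < n" using C by (simp add: nnf_circuit_def n)
  consider "i < n + n" | "i = n + n" | "i = Suc (n + n)" using i by linarith
  then show thesis
  proof cases
    case 1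
    then obtain pol i' where i': "i' < n" "i = node_copy n pol i'" by (rule node_copy_cases)
    then obtain pol' j' where j': "j = node_copy n pol' j'" "j' \<in> set (children (gates C ! i'))"
      using j children_quant_gate[of n L pol "gates C ! i'"] by (auto simp: quant_circuit_copy n)
    then have e': "(i', j') \<in> edges C" using i' by (simp add: edges_def n)
    then have "j' < n" using C by (auto simp: nnf_circuit_def n)
    then show thesis using that(1) e' i' j' by blast
  next
    case 2
    then show thesis using that(2) j by (simp add: quant_circuit_last[OF n])
  next
    case 3
    then show thesis using that(3) j r by (auto simp: quant_circuit_last[OF n])
  qed
qed

lemma acyclic_quant_circuit:
  assumes C: "nnf_circuit C"
  shows "acyclic (edges (quant_circuit L C))"
proof -
  define n where "n = length (gates C)"
  \<comment> \<open>The numbering of \<open>C\<close> need not be topological, so indices alone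
    cannot serve as a measure. All copies get rank 0 and are compared as nodes of \<open>C\<close>,
    where \<open>mod n\<close> forgets the polarity; the two extra gates lie above them, ordered by
    index.\<close>
  let ?f = "\<lambda>i. (if i < n + n then 0 else i, i mod n)"
  have "wf ((edges C)\<inverse>)"
    using C by (simp add: nnf_circuit_def finite_acyclic_wf_converse finite_edges)
  then have "wf (inv_image (less_than <*lex*> (edges C)\<inverse>) ?f)" by auto
  moreover have "(edges (quant_circuit L C))\<inverse> \<subseteq> inv_image (less_than <*lex*> (edges C)\<inverse>) ?f"
  proof clarify
    fix i j assume "(i, j) \<in> edges (quant_circuit L C)"
    from C this n_def show "(j, i) \<in> inv_image (less_than <*lex*> (edges C)\<inverse>) ?f"
    proof (cases rule: quant_circuit_edge_cases)
      case (1 pol i' pol' j')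
      then show ?thesis by (simp add: node_copy_less node_copy_mod)
    qed auto
  qed
  ultimately have "wf ((edges (quant_circuit L C))\<inverse>)" by (rule wf_subset)
  then show ?thesis using wf_acyclic acyclic_converse by blast
qed

lemma nnf_quant_circuit:
  assumes C: "nnf_circuit C"
  shows "nnf_circuit (quant_circuit L C)"
proof -
  let ?D = "quant_circuit L C"
  define n where "n = length (gates C)"
  have len: "length (gates ?D) = Suc (Suc (n + n))" by (simp add: n_def)
  have r: "root C < n" using C by (simp add: nnf_circuit_def n_def)
  have "j < length (gates ?D)" if "(i, j) \<in> edges ?D" for i j
    using C that n_def
    by (cases rule: quant_circuit_edge_cases)
      (auto simp: len node_copy_less less_Suc_eq simp del: length_quant_circuit)
  moreover have "(root ?D, i) \<in> (edges ?D)\<^sup>*" if i: "i < length (gates ?D)" for i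
  proof -
    have e1: "(Suc (n + n), n + n) \<in> edges ?D"
      unfolding edges_def using quant_circuit_last(2)[OF n_def, of L] by (simp add: n_def)
    have e2: "(n + n, j) \<in> edges ?D" if "j < n + n" for j
      unfolding edges_def using that quant_circuit_last(1)[OF n_def, of L] by (simp add: n_def)
    have "root ?D = Suc (n + n)" by (simp add: root_quant_circuit n_def)
    moreover consider "i < n + n" | "i = n + n" | "i = Suc (n + n)" using i len by linarith
    ultimately show ?thesis
      using e1 e2 by cases (auto intro: rtrancl_into_rtrancl)
  qed
  moreover have "children (gates ?D ! i) \<noteq> []"
    if i: "i < length (gates ?D)" and g: "\<not> is_leaf (gates ?D ! i)" for i
  proof -
    consider "i < n + n" | "i = n + n" | "i = Suc (n + n)" using i len by linarith
    then show ?thesis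
    proof cases
      case 1
      then obtain pol i' where i': "i' < n" "i = node_copy n pol i'" by (rule node_copy_cases)
      have "\<not> is_leaf (gates C ! i') \<longrightarrow> children (gates C ! i') \<noteq> []"
        using C i' by (simp add: nnf_circuit_def n_def)
      then show ?thesis
        using g i' children_quant_gate_nonempty by (simp add: quant_circuit_copy n_def)
    qed (use quant_circuit_last[OF n_def] r in auto)
  qed
  ultimately show ?thesis
    using acyclic_quant_circuit[OF C]
    unfolding nnf_circuit_def by (auto simp: root_quant_circuit)
qed

section \<open>Meaning of the copies\<close>

lemma child_less:
  assumes "nnf_circuit C" "i < length (gates C)" "c \<in> set (children (gates C ! i))"
  shows "c < length (gates C)"
  using assms by (auto simp: nnf_circuit_def edges_def)

text \<open>The induction follows fragments and skips the and-gates between them, whose copies are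
  evaluated on the spot. The polarity is general because a prime is needed negated whichever copy of
  the fragment is computed.\<close>

lemma eval_quant_circuit_copy:
  assumes nnf: "nnf_circuit C" and dec: "decomposable C"
    and node: "sdd_node C T i" and i: "i < length (gates C)"
  shows "eval \<sigma> (formula_at (quant_circuit L C) (node_copy (length (gates C)) pol i)) \<longleftrightarrow>
    (\<forall>\<tau>\<in>flips L \<sigma>. eval \<tau> (formula_at C i) = pol)"
  using node i
proof (induction arbitrary: pol rule: sdd_node.induct)
  let ?n = "length (gates C)" and ?D = "quant_circuit L C"
  have acC: "acyclic (edges C)" using nnf by (simp add: nnf_circuit_def)
  note acD = acyclic_quant_circuit[OF nnf, of L]
  have copy_less: "node_copy ?n pol j < length (gates ?D)" if "j < ?n" for pol j
    using node_copy_less[OF that, of pol] by simp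
  note evD = eval_formula_at[OF acD copy_less] and evC = eval_formula_at[OF acC]
  {
    case (const i b)
    then show ?case
      using flips_refl by (auto simp: evD evC quant_circuit_copy)
  next
    case (lit i l)
    have "(\<forall>\<tau>\<in>flips L \<sigma>. eval \<tau> (formula_at C i) = pol) \<longleftrightarrow>
      (\<forall>\<tau>\<in>flips L \<sigma>. eval_literal \<tau> (signed pol l))"
      using lit by (auto simp: evC signed_def eval_literal_compl)
    then show ?case
      using lit by (simp add: evD quant_circuit_copy forall_flips_literal)
  next
    case (fragment i cs els)
    note i_less = fragment.prems
    have c_less: "c < ?n" if "c \<in> set cs" for c
      using child_less[OF nnf i_less] that fragment.hyps(1) by simp
    have len: "length cs = length els" using fragment.hyps(2) by (rule list_all2_lengthD)
    define p where "p k = fst (els ! k)" for k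
    define s where "s k = snd (els ! k)" for k
    have gate: "gates C ! (cs ! k) = And [p k, s k]" if "k < length els" for k
      using list_all2_nthD2[OF fragment.hyps(2) that]
      by (simp add: p_def s_def split: prod.splits)
    have in_els: "(p k, s k) \<in> set els" if "k < length els" for k
      using that by (simp add: p_def s_def)
    have cs_less: "cs ! k < ?n" if "k < length els" for k
      using that c_less len by simp
    have ps_less: "p k < ?n" "s k < ?n" if "k < length els" for k
      using child_less[OF nnf cs_less[OF that]] gate[OF that] by auto
    have disj: "vars (formula_at C (p k)) \<inter> vars (formula_at C (s k)) = {}"
      if k: "k < length els" for k
    proof -
      have "\<forall>a < length [p k, s k]. \<forall>b < length [p k, s k]. a \<noteq> b \<longrightarrow>
        vars (formula_at C ([p k, s k] ! a)) \<inter> vars (formula_at C ([p k, s k] ! b)) = {}"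
        using dec cs_less[OF k] gate[OF k] unfolding decomposable_def by blast
      from this[rule_format, of 0 1] show ?thesis by simp
    qed
    have bex: "(\<exists>c\<in>set cs. Q c) \<longleftrightarrow> (\<exists>k<length els. Q (cs ! k))" for Q
      using len by (metis in_set_conv_nth)
    have ball: "(\<forall>c\<in>set cs. Q c) \<longleftrightarrow> (\<forall>k<length els. Q (cs ! k))" for Q
      using len by (metis in_set_conv_nth)
    have unique: "\<exists>!k. k < length els \<and> eval \<tau> (formula_at C (p k))" for \<tau>
    proof -
      have "map (\<lambda>(p, s). formula_at C p) els ! k = formula_at C (p k)" if "k < length els" for k
        using that by (simp add: p_def split: prod.splits)
      then show ?thesis
        using partition_formulas_unique[OF fragment.hyps(6), of \<tau>] by (simp cong: conj_cong)
    qed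
    \<comment> \<open>Clauses of false primes hold trivially, so the single true prime decides: its
      sub must have the value \<open>pol\<close>. This works alike for both polarities.\<close>
    have frag: "eval \<tau> (formula_at C i) = pol \<longleftrightarrow>
      (\<forall>k<length els. eval \<tau> (formula_at C (p k)) = False \<or> eval \<tau> (formula_at C (s k)) = pol)"
      for \<tau>
    proof -
      have "eval \<tau> (formula_at C i) \<longleftrightarrow>
        (\<exists>k<length els. eval \<tau> (formula_at C (p k)) \<and> eval \<tau> (formula_at C (s k)))"
        using i_less fragment.hyps(1) by (simp add: evC bex gate cs_less cong: conj_cong)
      then show ?thesis using unique[of \<tau>] by (cases pol) auto
    qed
    have copy_c: "eval \<sigma> (formula_at ?D (node_copy ?n pol (cs ! k))) \<longleftrightarrow>
      (\<forall>\<tau>\<in>flips L \<sigma>. eval \<tau> (formula_at C (p k)) = False) \<or>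
      (\<forall>\<tau>\<in>flips L \<sigma>. eval \<tau> (formula_at C (s k)) = pol)" if k: "k < length els" for k
      using fragment.IH(1)[OF in_els[OF k] ps_less(1)[OF k], of False]
        fragment.IH(2)[OF in_els[OF k] ps_less(2)[OF k], of pol]
      by (simp add: evD quant_circuit_copy cs_less k gate)
    have "eval \<sigma> (formula_at ?D (node_copy ?n pol i)) \<longleftrightarrow>
      (\<forall>k<length els. eval \<sigma> (formula_at ?D (node_copy ?n pol (cs ! k))))"
      using i_less fragment.hyps(1) by (simp add: evD quant_circuit_copy ball)
    \<comment> \<open>Each clause joins a prime and its own sub, which have no common variable, so
      the two separate quantifications merge into one over the clause.\<close>
    also have "\<dots> \<longleftrightarrow> (\<forall>\<tau>\<in>flips L \<sigma>. \<forall>k<length els.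
      eval \<tau> (formula_at C (p k)) = False \<or> eval \<tau> (formula_at C (s k)) = pol)"
      using copy_c forall_flips_disj[OF disj] by blast
    also have "\<dots> \<longleftrightarrow> (\<forall>\<tau>\<in>flips L \<sigma>. eval \<tau> (formula_at C i) = pol)"
      unfolding frag by blast
    finally show ?case .
  }
qed

lemma equivalent_quant_circuit:
  assumes "sdd_circuit C"
  shows "equivalent (formula_of (quant_circuit (set ls) C)) (forall_literals ls (formula_of C))"
  unfolding equivalent_def
proof
  fix \<sigma>
  let ?D = "quant_circuit (set ls) C"
  define n where "n = length (gates C)"
  obtain T where C: "nnf_circuit C" "decomposable C" "sdd_node C T (root C)"
    using assms by (auto simp: sdd_circuit_def)
  then have r: "root C < n" by (simp add: nnf_circuit_def n_def)
  note ev = eval_formula_at[OF acyclic_quant_circuit[OF C(1), of "set ls"]]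
  have "eval \<sigma> (formula_at ?D (Suc (n + n))) \<longleftrightarrow>
    eval \<sigma> (formula_at ?D (root C)) \<and> eval \<sigma> (formula_at ?D (n + n))"
    using ev[of "Suc (n + n)"] quant_circuit_last(2)[OF n_def] by (simp add: n_def)
  moreover have "eval \<sigma> (formula_at ?D (n + n)) \<longleftrightarrow> (\<exists>j<n + n. eval \<sigma> (formula_at ?D j))"
    using ev[of "n + n"] quant_circuit_last(1)[OF n_def] by (auto simp: n_def)
  ultimately have "eval \<sigma> (formula_of ?D) \<longleftrightarrow> eval \<sigma> (formula_at ?D (root C))"
    using r by (auto simp: formula_of_def root_quant_circuit n_def intro: trans_less_add1)
  also have "\<dots> \<longleftrightarrow> (\<forall>\<tau>\<in>flips (set ls) \<sigma>. eval \<tau> (formula_of C))"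
    using eval_quant_circuit_copy[OF C, of \<sigma> "set ls" True] r
    by (simp add: node_copy_def n_def formula_of_def)
  finally show "eval \<sigma> (formula_of ?D) = eval \<sigma> (forall_literals ls (formula_of C))"
    by (simp add: eval_forall_literals)
qed

section \<open>Total correctness of programs\<close>

text \<open>A weakest precondition for total correctness whose postcondition also receives the
  running time. As execution is deterministic, it satisfies equations, and the simplifier can
  execute straight-line code symbolically.\<close>

definition runs :: "program \<Rightarrow> state \<Rightarrow> (nat \<Rightarrow> state \<Rightarrow> bool) \<Rightarrow> bool" where
  "runs P s Q \<longleftrightarrow> (\<exists>t s'. exec P s t s' \<and> Q t s')"

lemma runs_exec: "exec P s t s' \<Longrightarrow> runs P s Q = Q t s'"
  unfolding runs_def using exec_deterministic by blast

lemma runs_simps [simp]: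
  "runs (SetConst r n) s Q = Q 1 (set_reg r n s)"
  "runs (Copy r q) s Q = Q 1 (set_reg r (reg s q) s)"
  "runs (Succ r q) s Q = Q 1 (set_reg r (Suc (reg s q)) s)"
  "runs (Read r a q) s Q = Q 1 (set_reg r (arr s a (reg s q)) s)"
  "runs (Write a q r) s Q = Q 1 (set_arr a (reg s q) (reg s r) s)"
  "runs (Seq P R) s Q = runs P s (\<lambda>t s'. runs R s' (\<lambda>u. Q (t + u)))"
  "runs (If b P R) s Q =
     (if holds b s then runs P s (\<lambda>t. Q (Suc t)) else runs R s (\<lambda>t. Q (Suc t)))"
proof -
  show "runs (Seq P R) s Q = runs P s (\<lambda>t s'. runs R s' (\<lambda>u. Q (t + u)))"
    unfolding runs_def by (blast intro: exec.seq elim!: exec_SeqE)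
  show "runs (If b P R) s Q =
    (if holds b s then runs P s (\<lambda>t. Q (Suc t)) else runs R s (\<lambda>t. Q (Suc t)))"
    unfolding runs_def
    using exec.if_true[of b s P _ _ R] exec.if_false[of b s R _ _ P]
    by (auto elim!: exec_IfE) blast+
qed (use runs_exec[OF exec.set_const] runs_exec[OF exec.copy] runs_exec[OF exec.succ]
    runs_exec[OF exec.read_arr] runs_exec[OF exec.write_arr] in simp_all)

text \<open>Keeps the simplifier from executing a continuation before its initial state is known.\<close>

lemma runs_cong [cong]: "P = P' \<Longrightarrow> s = s' \<Longrightarrow> runs P s Q = runs P' s' Q"
  by simp

lemma runs_mono:
  "runs P s Q \<Longrightarrow> (\<And>t s'. Q t s' \<Longrightarrow> Q' t s') \<Longrightarrow> runs P s Q'"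
  unfolding runs_def by blast

text \<open>Composition with separate time budgets; the intermediate assertion hides the exact time
  and state of the first program.\<close>

lemma runs_SeqI:
  assumes "runs P s (\<lambda>t s'. t \<le> c \<and> I s')" and "\<And>s'. I s' \<Longrightarrow> runs R s' (\<lambda>t s''. t \<le> d \<and> Q s'')"
  shows "runs (Seq P R) s (\<lambda>t s''. t \<le> c + d \<and> Q s'')"
  unfolding runs_simps
  by (rule runs_mono[OF assms(1)]) (auto intro!: runs_mono[OF assms(2)])

text \<open>The budget may differ between iterations: a loop over the gates then costs the sum of
  their numbers of children, where a uniform bound would give a product. Each \<open>Suc\<close>
  inside the sum pays for a successful test, the outer one for the last, failing test.\<close>

lemma runs_While:
  fixes c :: "nat \<Rightarrow> nat"
  assumes step: "\<And>k s. k < N \<Longrightarrow> I k s \<Longrightarrow> holds b s \<and> runs P s (\<lambda>t s'. t \<le> c k \<and> I (Suc k) s')"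
    and stop: "\<And>s. I N s \<Longrightarrow> \<not> holds b s"
    and init: "I 0 s"
  shows "runs (While b P) s (\<lambda>t s'. t \<le> Suc (\<Sum>k<N. Suc (c k)) \<and> I N s')"
proof -
  \<comment> \<open>Generalised to a loop entered at iteration \<open>j\<close>, for induction from
    \<open>N\<close> downwards.\<close>
  have "runs (While b P) s (\<lambda>t s'. t \<le> Suc (\<Sum>k=j..<N. Suc (c k)) \<and> I N s')"
    if "j \<le> N" "I j s" for j s
    using that
  proof (induction j arbitrary: s rule: inc_induct)
    case base
    then show ?case
      unfolding runs_def by (intro exI conjI) (rule while_false, auto dest: stop)
  next
    case (step k)
    obtain t s' where 1: "holds b s" "exec P s t s'" "t \<le> c k" "I (Suc k) s'"
      using assms(1)[OF step.hyps(2) step.prems] by (auto simp: runs_def)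
    obtain u s'' where 2: "exec (While b P) s' u s''" "u \<le> Suc (\<Sum>k=Suc k..<N. Suc (c k))" "I N s''"
      using step.IH[OF 1(4)] by (auto simp: runs_def)
    have "exec (While b P) s (1 + t + u) s''" using 1 2 by (intro while_true)
    moreover have "1 + t + u \<le> Suc (\<Sum>k=k..<N. Suc (c k))"
      using 1 2 step.hyps by (simp add: sum.atLeast_Suc_lessThan)
    ultimately show ?case using 2 by (auto simp: runs_def)
  qed
  from this[of 0 s, unfolded atLeast0LessThan] show ?thesis using init by blast
qed

lemma state_simps [simp]:
  "reg (set_reg r v s) = (reg s)(r := v)"
  "arr (set_reg r v s) = arr s"
  "reg (set_arr a k v s) = reg s"
  "arr (set_arr a k v s) = (arr s)(a := (arr s a)(k := v))"
  "set_reg r v (set_reg r w s) = set_reg r v s"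
  by (simp_all add: set_reg_def set_arr_def)

section \<open>The program\<close>

text \<open>
  Registers 10 and 11 hold the current node and its second copy, 12 the first free position
  of the output array 11 of children, 13 and 14 an interval of the input array 3 of children, 15
  and 16 the tag and the argument of the current node. Arrays 12 and 13 tabulate the two
  copies of a node, since the machine cannot add.
\<close>

definition copy_table :: "bool \<Rightarrow> nat" where
  "copy_table pol = (if pol then 12 else 13)"

definition copy_register :: "bool \<Rightarrow> nat" where
  "copy_register pol = (if pol then 10 else 11)"

definition append_child :: "bool \<Rightarrow> program" where
  "append_child pol =
     Seq (Read 17 3 13) (Seq (Read 17 (copy_table pol) 17) (Seq (Write 11 12 17)
       (Seq (Succ 13 13) (Succ 12 12))))"

definition append_children :: "bool \<Rightarrow> program" where
  "append_children pol = While (Less 13 14) (append_child pol)"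

definition on_tag :: "nat \<Rightarrow> program \<Rightarrow> program \<Rightarrow> program" where
  "on_tag t P R = Seq (SetConst 18 t) (If (Equal 15 18) P R)"

definition emit_const :: "bool \<Rightarrow> bool \<Rightarrow> program" where
  "emit_const pol b =
     Seq (SetConst 17 (if b = pol then 1 else 0)) (Write 8 (copy_register pol) 17)"

text \<open>The bit read is that of the complement of the literal to be emitted, which is positive
  iff \<open>positive = pol\<close>. If it is set, tag 0 is written, the constant false; the
  variable stored besides does no harm.\<close>

definition emit_literal :: "nat \<Rightarrow> bool \<Rightarrow> bool \<Rightarrow> program" where
  "emit_literal b pol positive =
     Seq (Read 17 (if positive = pol then Suc b else b) 16) (Seq (SetConst 18 1)
       (Seq (If (Equal 17 18) (SetConst 17 0) (SetConst 17 (if positive = pol then 2 else 3)))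
         (Seq (Write 8 (copy_register pol) 17) (Write 9 (copy_register pol) 16))))"

definition emit_begin :: "bool \<Rightarrow> nat \<Rightarrow> program" where
  "emit_begin pol t =
     Seq (SetConst 17 t) (Seq (Write 8 (copy_register pol) 17)
       (Seq (Write 9 (copy_register pol) 12) (Seq (Copy 13 16) (Read 14 2 10))))"

definition emit_end :: "bool \<Rightarrow> program" where
  "emit_end pol = Seq (append_children pol) (Write 10 (copy_register pol) 12)"

text \<open>Tag 5 marks an or-gate. The prime is translated by the table of negated copies before
  the loop handles the remaining child.\<close>

definition emit_and :: "bool \<Rightarrow> program" where
  "emit_and pol = Seq (emit_begin pol 5) (Seq (append_child False) (emit_end pol))"

definition emit_or :: "bool \<Rightarrow> program" where
  "emit_or pol = Seq (emit_begin pol 4) (emit_end pol)"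

definition emit_gate :: "nat \<Rightarrow> bool \<Rightarrow> program" where
  "emit_gate b pol =
     Seq (Read 15 0 10) (Seq (Read 16 1 10)
       (on_tag 0 (emit_const pol False)
       (on_tag 1 (emit_const pol True)
       (on_tag 2 (emit_literal b pol True)
       (on_tag 3 (emit_literal b pol False)
       (on_tag 4 (emit_and pol) (emit_or pol)))))))"

definition make_tables :: program where
  "make_tables =
     Seq (SetConst 10 0) (Seq (Copy 11 0)
       (While (Less 10 0)
         (Seq (Write 12 10 10) (Seq (Write 13 10 11) (Seq (Succ 10 10) (Succ 11 11))))))"

definition emit_gates :: "nat \<Rightarrow> program" where
  "emit_gates b =
     Seq (SetConst 10 0) (Seq (Copy 11 0) (Seq (SetConst 12 0)
       (While (Less 10 0)
         (Seq (emit_gate b True) (Seq (emit_gate b False) (Seq (Succ 10 10) (Succ 11 11)))))))"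

text \<open>Register 11 has reached \<open>n + n\<close> when the loop over the gates ends, so it
  holds the index of the gate written here.\<close>

definition emit_all_nodes :: program where
  "emit_all_nodes =
     Seq (SetConst 17 5) (Seq (Write 8 11 17) (Seq (Write 9 11 12) (Seq (SetConst 13 0)
       (Seq (While (Less 13 11) (Seq (Write 11 12 13) (Seq (Succ 12 12) (Succ 13 13))))
         (Write 10 11 12)))))"

definition emit_root :: program where
  "emit_root =
     Seq (Succ 13 11) (Seq (SetConst 17 4) (Seq (Write 8 13 17) (Seq (Write 9 13 12)
       (Seq (Write 11 12 1) (Seq (Succ 12 12) (Seq (Write 11 12 11) (Seq (Succ 12 12)
         (Write 10 13 12))))))))"

definition quantify :: "nat \<Rightarrow> program" where
  "quantify b =
     Seq make_tables (Seq (emit_gates b) (Seq emit_all_nodes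
       (Seq emit_root (Seq (Copy 9 13) (Succ 8 13)))))"

text \<open>
  The array of literals cannot be cleared as a whole, since its entries are indexed by arbitrary
  variables. It is cleared at the arguments of all gates, which include the occurring variables.
\<close>

definition clear_literals :: program where
  "clear_literals =
     Seq (SetConst 10 0) (Seq (SetConst 17 0)
       (While (Less 10 0)
         (Seq (Read 16 1 10) (Seq (Write 6 16 17) (Seq (Write 7 16 17) (Succ 10 10))))))"

definition enter_literals :: program where
  "enter_literals =
     Seq (SetConst 10 0) (Seq (SetConst 18 1)
       (While (Less 10 4)
         (Seq (Read 16 4 10) (Seq (Read 15 5 10)
           (Seq (If (Equal 15 18) (Write 6 16 18) (Write 7 16 18)) (Succ 10 10))))))"

section \<open>Correctness of the program\<close>

text \<open>Restricted to entries that the program reads, since a table built from a list can be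
  initialised only there. Both representations of the literals provide this.\<close>

definition occurring_literal_table :: "nat \<Rightarrow> state \<Rightarrow> literal set \<Rightarrow> circuit \<Rightarrow> bool" where
  "occurring_literal_table b s L C \<longleftrightarrow>
     (\<forall>l. Lit l \<in> set (gates C) \<longrightarrow>
        arr s b (var l) = (if Pos (var l) \<in> L then 1 else 0) \<and>
        arr s (Suc b) (var l) = (if Neg (var l) \<in> L then 1 else 0))"

definition ready :: "nat \<Rightarrow> literal set \<Rightarrow> circuit \<Rightarrow> state \<Rightarrow> bool" where
  "ready b L C s \<longleftrightarrow>
     nnf_circuit C \<and> stores_circuit 0 s C \<and> occurring_literal_table b s L C \<and>
     (\<forall>pol. \<forall>j<length (gates C). arr s (copy_table pol) j = node_copy (length (gates C)) pol j)"

text \<open>The bound on the end of the children keeps them below the first free position, so that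
  later appending cannot overwrite them.\<close>

definition stored :: "state \<Rightarrow> nat \<Rightarrow> gate \<Rightarrow> bool" where
  "stored s j g \<longleftrightarrow> stores_gate 8 s j g \<and> (is_leaf g \<or> arr s 10 j \<le> reg s 12)"

text \<open>Frame condition for emitting gate \<open>j\<close>: arrays 8 to 10 change only at
  \<open>j\<close>, array 11 only from the free position on. Registers above 12 are scratch.\<close>

definition writes_gate :: "nat \<Rightarrow> state \<Rightarrow> state \<Rightarrow> bool" where
  "writes_gate j s s' \<longleftrightarrow>
     (\<forall>r. r < 12 \<longrightarrow> reg s' r = reg s r) \<and> reg s 12 \<le> reg s' 12 \<and>
     (\<forall>a. a < 8 \<or> 11 < a \<longrightarrow> arr s' a = arr s a) \<and>
     (\<forall>a\<in>{8, 9, 10}. \<forall>k. k \<noteq> j \<longrightarrow> arr s' a k = arr s a k) \<and>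
     (\<forall>k < reg s 12. arr s' 11 k = arr s 11 k)"

section \<open>Preservation of the input and of gates already written\<close>

lemma stores_gate_cong:
  assumes "\<And>a. a \<in> {b, Suc b, Suc (Suc b)} \<Longrightarrow> arr s' a i = arr s a i"
    and "\<And>k. \<not> is_leaf g \<Longrightarrow> k < arr s (Suc (Suc b)) i \<Longrightarrow> arr s' (b + 3) k = arr s (b + 3) k"
  shows "stores_gate b s i g \<Longrightarrow> stores_gate b s' i g"
  using assms by (induction b s i g rule: stores_gate.induct) (auto simp: stores_children_def)

lemma stored_mono:
  assumes "stored s j g" "writes_gate i s s'" "i \<noteq> j"
  shows "stored s' j g"
proof -
  have "stores_gate 8 s' j g"
    by (rule stores_gate_cong[where s = s]) (use assms in \<open>auto simp: stored_def writes_gate_def\<close>)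
  then show ?thesis using assms by (auto simp: stored_def writes_gate_def)
qed

text \<open>With \<open>b < 7\<close> the literal table lies in arrays below 8, apart from the
  output arrays 8 to 11.\<close>

lemma ready_mono:
  assumes "ready b L C s" "b < 7" "\<And>r. r < 2 \<Longrightarrow> reg s' r = reg s r"
    and arr: "\<And>a. a < 8 \<or> 11 < a \<Longrightarrow> arr s' a = arr s a"
  shows "ready b L C s'"
proof -
  have "stores_gate 0 s' i (gates C ! i)" if "i < length (gates C)" for i
    by (rule stores_gate_cong[where s = s])
      (use assms that in \<open>auto simp: ready_def stores_circuit_def\<close>)
  then have "stores_circuit 0 s' C"
    using assms by (simp add: ready_def stores_circuit_def)
  moreover have "arr s' b = arr s b" "arr s' (Suc b) = arr s (Suc b)"
    using arr assms(2) by simp_all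
  moreover have "arr s' (copy_table pol) = arr s (copy_table pol)" for pol
    using arr by (simp add: copy_table_def)
  ultimately show ?thesis
    using assms(1) by (simp add: ready_def occurring_literal_table_def)
qed

section \<open>Emission of a single gate\<close>

lemma runs_append_children:
  assumes "reg s 14 = reg s 13 + length cs"
    and "\<And>k. k < length cs \<Longrightarrow> arr s 3 (reg s 13 + k) = cs ! k"
    and "\<And>c. c \<in> set cs \<Longrightarrow> arr s (copy_table pol) c = f c"
  shows "runs (append_children pol) s (\<lambda>t s'. t \<le> Suc (6 * length cs) \<and>
    (\<forall>r. r < 12 \<longrightarrow> reg s' r = reg s r) \<and> reg s' 12 = reg s 12 + length cs \<and>
    (\<forall>a. a \<noteq> 11 \<longrightarrow> arr s' a = arr s a) \<and>
    (\<forall>k < reg s 12. arr s' 11 k = arr s 11 k) \<and>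
    (\<forall>k < length cs. arr s' 11 (reg s 12 + k) = f (cs ! k)))"
proof -
  define I where "I m s' \<longleftrightarrow>
    (\<forall>r. r < 12 \<or> r = 14 \<longrightarrow> reg s' r = reg s r) \<and> reg s' 12 = reg s 12 + m \<and>
    reg s' 13 = reg s 13 + m \<and> (\<forall>a. a \<noteq> 11 \<longrightarrow> arr s' a = arr s a) \<and>
    (\<forall>k < reg s 12. arr s' 11 k = arr s 11 k) \<and>
    (\<forall>k < m. arr s' 11 (reg s 12 + k) = f (cs ! k))" for m s'
  have "runs (append_children pol) s
    (\<lambda>t s'. t \<le> Suc (\<Sum>k<length cs. Suc 5) \<and> I (length cs) s')"
    unfolding append_children_def
  proof (rule runs_While)
    fix m s' assume "m < length cs" "I m s'"
    then show "holds (Less 13 14) s' \<and>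
        runs (append_child pol) s' (\<lambda>t s''. t \<le> 5 \<and> I (Suc m) s'')"
      using assms
      by (auto simp: I_def append_child_def copy_table_def less_Suc_eq)
  qed (use assms(1) in \<open>auto simp: I_def\<close>)
  then show ?thesis
    by (rule runs_mono) (auto simp: I_def)
qed

lemma runs_emit_end:
  assumes "reg s 14 = reg s 13 + length cs"
    and "\<And>k. k < length cs \<Longrightarrow> arr s 3 (reg s 13 + k) = cs ! k"
    and "\<And>c. c \<in> set cs \<Longrightarrow> arr s (copy_table pol) c = f c"
    and "d = reg s (copy_register pol)"
  shows "runs (emit_end pol) s (\<lambda>t s'. t \<le> 2 + 6 * length cs \<and>
    writes_gate d s s' \<and> reg s' 12 = reg s 12 + length cs \<and>
    arr s' 8 = arr s 8 \<and> arr s' 9 = arr s 9 \<and> arr s' 10 d = reg s' 12 \<and>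
    (\<forall>k < length cs. arr s' 11 (reg s 12 + k) = f (cs ! k)))"
  unfolding emit_end_def runs_simps
  by (rule runs_mono[OF runs_append_children[OF assms(1-3)]])
    (auto simp: assms(4) writes_gate_def copy_register_def)

lemma writes_gate_trans:
  assumes 1: "writes_gate d s s'" and 2: "writes_gate d s' s''"
  shows "writes_gate d s s''"
proof -
  have "arr s'' 11 k = arr s 11 k" if "k < reg s 12" for k
    using that 1 2 by (simp add: writes_gate_def)
  then show ?thesis using 1 2 by (simp add: writes_gate_def)
qed

lemma runs_emit_begin:
  assumes "d = reg s (copy_register pol)"
  shows "runs (emit_begin pol t) s (\<lambda>u s'. u = 5 \<and> writes_gate d s s' \<and> reg s' 12 = reg s 12 \<and>
    reg s' 13 = reg s 16 \<and> reg s' 14 = arr s 2 (reg s 10) \<and> arr s' 8 d = t \<and> arr s' 9 d = reg s 12)"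
  by (cases pol) (simp_all add: assms emit_begin_def writes_gate_def copy_register_def)

lemma runs_append_child:
  "runs (append_child pol) s (\<lambda>u s'. u = 5 \<and> writes_gate d s s' \<and> reg s' 12 = Suc (reg s 12) \<and>
    reg s' 13 = Suc (reg s 13) \<and> reg s' 14 = reg s 14 \<and> arr s' 8 = arr s 8 \<and> arr s' 9 = arr s 9 \<and>
    arr s' 11 (reg s 12) = arr s (copy_table pol) (arr s 3 (reg s 13)))"
  by (simp add: append_child_def copy_table_def writes_gate_def)

lemma runs_emit_or:
  assumes "reg s 16 = x" "arr s 2 (reg s 10) = x + length cs"
    and "\<And>k. k < length cs \<Longrightarrow> arr s 3 (x + k) = cs ! k"
    and "\<And>c. c \<in> set cs \<Longrightarrow> arr s (copy_table pol) c = f c"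
    and "d = reg s (copy_register pol)"
  shows "runs (emit_or pol) s (\<lambda>u s'. u \<le> 7 + 6 * length cs \<and>
    writes_gate d s s' \<and> arr s' 8 d = 4 \<and> stores_children 8 s' d (map f cs) \<and>
    arr s' 10 d \<le> reg s' 12)"
  unfolding emit_or_def runs_simps
proof (rule runs_mono[OF runs_emit_begin[OF assms(5)]], elim conjE)
  fix u :: nat and s1
  assume s1: "u = 5" "writes_gate d s s1" "reg s1 12 = reg s 12" "reg s1 13 = reg s 16"
    "reg s1 14 = arr s 2 (reg s 10)" "arr s1 8 d = 4" "arr s1 9 d = reg s 12"
  have arr: "arr s1 3 = arr s 3" "arr s1 (copy_table pol) = arr s (copy_table pol)"
    using s1(2) by (simp_all add: writes_gate_def copy_table_def)
  have d: "d = reg s1 (copy_register pol)"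
    using s1(2) assms(5) by (simp add: writes_gate_def copy_register_def)
  show "runs (emit_end pol) s1 (\<lambda>ua s'. u + ua \<le> 7 + 6 * length cs \<and>
    writes_gate d s s' \<and> arr s' 8 d = 4 \<and> stores_children 8 s' d (map f cs) \<and>
    arr s' 10 d \<le> reg s' 12)"
    by (rule runs_mono, rule runs_emit_end[where cs = cs and f = f and d = d])
      (use s1 assms arr d in \<open>auto simp: stores_children_def intro: writes_gate_trans\<close>)
qed

lemma runs_emit_and:
  assumes "reg s 16 = x" "arr s 2 (reg s 10) = x + Suc (length cs)" "arr s 3 x = c"
    and "\<And>k. k < length cs \<Longrightarrow> arr s 3 (Suc (x + k)) = cs ! k"
    and "arr s (copy_table False) c = c'"
    and "\<And>c. c \<in> set cs \<Longrightarrow> arr s (copy_table pol) c = f c"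
    and "d = reg s (copy_register pol)"
  shows "runs (emit_and pol) s
    (\<lambda>u s'. u \<le> 12 + 6 * length cs \<and>
    writes_gate d s s' \<and> arr s' 8 d = 5 \<and> stores_children 8 s' d (c' # map f cs) \<and>
    arr s' 10 d \<le> reg s' 12)"
  unfolding emit_and_def runs_simps
proof (rule runs_mono[OF runs_emit_begin[OF assms(7)]], elim conjE,
    rule runs_mono[OF runs_append_child[where d = d]], elim conjE)
  fix u v :: nat and s1 s2
  assume s1: "u = 5" "writes_gate d s s1" "reg s1 12 = reg s 12" "reg s1 13 = reg s 16"
    "reg s1 14 = arr s 2 (reg s 10)" "arr s1 8 d = 5" "arr s1 9 d = reg s 12"
  assume s2: "v = 5" "writes_gate d s1 s2" "reg s2 12 = Suc (reg s1 12)"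
    "reg s2 13 = Suc (reg s1 13)" "reg s2 14 = reg s1 14" "arr s2 8 = arr s1 8" "arr s2 9 = arr s1 9"
    "arr s2 11 (reg s1 12) = arr s1 (copy_table False) (arr s1 3 (reg s1 13))"
  have w: "writes_gate d s s2" using s1(2) s2(2) by (rule writes_gate_trans)
  have arr: "arr s1 3 = arr s 3" "arr s1 (copy_table False) = arr s (copy_table False)"
    "arr s2 3 = arr s 3" "arr s2 (copy_table pol) = arr s (copy_table pol)"
    using s1(2) w by (simp_all add: writes_gate_def copy_table_def)
  have d: "d = reg s2 (copy_register pol)"
    using w assms(7) by (simp add: writes_gate_def copy_register_def)
  show "runs (emit_end pol) s2 (\<lambda>ub s'. u + (v + ub) \<le> 12 + 6 * length cs \<and>
    writes_gate d s s' \<and> arr s' 8 d = 5 \<and> stores_children 8 s' d (c' # map f cs) \<and>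
    arr s' 10 d \<le> reg s' 12)"
  proof (rule runs_mono, rule runs_emit_end[where cs = cs and f = f and d = d])
    fix x :: nat and s3
    assume "x \<le> 2 + 6 * length cs \<and> writes_gate d s2 s3 \<and> reg s3 12 = reg s2 12 + length cs \<and>
      arr s3 8 = arr s2 8 \<and> arr s3 9 = arr s2 9 \<and> arr s3 10 d = reg s3 12 \<and>
      (\<forall>k < length cs. arr s3 11 (reg s2 12 + k) = f (cs ! k))"
    then have s3: "x \<le> 2 + 6 * length cs" "writes_gate d s2 s3" "reg s3 12 = reg s2 12 + length cs"
      "arr s3 8 = arr s2 8" "arr s3 9 = arr s2 9" "arr s3 10 d = reg s3 12"
      "\<And>k. k < length cs \<Longrightarrow> arr s3 11 (reg s2 12 + k) = f (cs ! k)"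
      by simp_all
    have "arr s3 11 (reg s 12) = c'"
      using s3(2) s2 s1 assms arr by (simp add: writes_gate_def)
    then have "stores_children 8 s3 d (c' # map f cs)"
      using s1 s2 s3 by (auto simp: stores_children_def nth_Cons split: nat.split)
    then show "u + (v + x) \<le> 12 + 6 * length cs \<and>
      writes_gate d s s3 \<and> arr s3 8 d = 5 \<and> stores_children 8 s3 d (c' # map f cs) \<and>
      arr s3 10 d \<le> reg s3 12"
      using s1 s2 s3 w by (auto intro: writes_gate_trans)
  qed (use s1 s2 assms arr d in auto)
qed

lemma writes_gate_set_reg [simp]:
  "12 < r \<Longrightarrow> writes_gate d (set_reg r v s) s' = writes_gate d s s'"
  by (simp add: writes_gate_def)

lemma runs_emit_const:
  assumes "d = reg s (copy_register pol)"
  shows "runs (emit_const pol v) s (\<lambda>t s'. t \<le> 2 \<and> writes_gate d s s' \<and> stored s' d (Const (v = pol)))"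
  by (cases pol) (simp_all add: assms emit_const_def writes_gate_def stored_def copy_register_def)

lemma runs_emit_literal:
  assumes "d = reg s (copy_register pol)"
    and "reg s 16 = var l" "positive = (l = Pos (var l))"
    and "arr s b (var l) = (if Pos (var l) \<in> L then 1 else 0)"
    and "arr s (Suc b) (var l) = (if Neg (var l) \<in> L then 1 else 0)"
  shows "runs (emit_literal b pol positive) s
    (\<lambda>t s'. t \<le> 6 \<and> writes_gate d s s' \<and> stored s' d (quant_gate n L pol (Lit l)))"
  using assms
  by (cases pol; cases l)
    (simp_all add: emit_literal_def writes_gate_def stored_def copy_register_def signed_def)

lemma stores_children_0:
  "stores_children 0 s i cs \<longleftrightarrow> arr s 2 i = arr s 1 i + length cs \<and>
    (\<forall>k<length cs. arr s 3 (arr s 1 i + k) = cs ! k)"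
  by (simp add: stores_children_def numeral_2_eq_2)

text \<open>The constant 40 generously covers the dispatch on the tag and all work independent of
  the number of children; each child costs five instructions and a test.\<close>

lemma runs_emit_gate:
  assumes ready: "ready b L C s" and b: "b < 7" and n: "n = length (gates C)" and i: "i < n"
    and regs: "reg s 10 = i" "reg s 11 = n + i"
  shows "runs (emit_gate b pol) s (\<lambda>t s'. t \<le> 40 + 6 * length (children (gates C ! i)) \<and>
    writes_gate (node_copy n pol i) s s' \<and>
    stored s' (node_copy n pol i) (quant_gate n L pol (gates C ! i)))"
proof -
  define d where "d = node_copy n pol i"
  have d: "reg s (copy_register pol) = d"
    using regs by (simp add: copy_register_def d_def node_copy_def)
  have cr: "copy_register pol \<noteq> r" if "r > 11" for r
    using that by (auto simp: copy_register_def)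
  have gate: "stores_gate 0 s i (gates C ! i)"
    using ready i n by (simp add: ready_def stores_circuit_def)
  have table: "arr s (copy_table pol) c = node_copy n pol c"
    if "c \<in> set (children (gates C ! i))" for c pol
    using ready child_less[of C i c] that i n by (simp add: ready_def)
  show ?thesis
    unfolding d_def[symmetric]
  proof (cases "gates C ! i")
    case (Const v)
    show "runs (emit_gate b pol) s (\<lambda>t s'. t \<le> 40 + 6 * length (children (gates C ! i)) \<and>
      writes_gate d s s' \<and> stored s' d (quant_gate n L pol (gates C ! i)))"
      using gate regs d cr
      by (cases v; simp add: emit_gate_def on_tag_def Const)
        (rule runs_mono, rule runs_emit_const[where d = d], simp_all add: Const)+
  next
    case (Lit l)
    then have "Lit l \<in> set (gates C)" using i n by (metis nth_mem)
    then have table: "arr s b (var l) = (if Pos (var l) \<in> L then 1 else 0)"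
      "arr s (Suc b) (var l) = (if Neg (var l) \<in> L then 1 else 0)"
      using ready by (auto simp: ready_def occurring_literal_table_def)
    show "runs (emit_gate b pol) s (\<lambda>t s'. t \<le> 40 + 6 * length (children (gates C ! i)) \<and>
      writes_gate d s s' \<and> stored s' d (quant_gate n L pol (gates C ! i)))"
      using table gate regs d cr
      by (cases l; simp add: emit_gate_def on_tag_def Lit del: quant_gate.simps)
        (rule runs_mono, rule runs_emit_literal[where d = d and L = L and l = l and n = n],
          simp_all add: Lit del: quant_gate.simps)+
  next
    case (And cs')
    then have "cs' \<noteq> []"
      using ready i n by (auto simp: ready_def nnf_circuit_def)
    then obtain c cs where cs: "cs' = c # cs" by (cases cs') auto
    have st: "arr s 0 i = 4" "arr s 2 i = arr s 1 i + Suc (length cs)"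
      "\<And>k. k < Suc (length cs) \<Longrightarrow> arr s 3 (arr s 1 i + k) = (c # cs) ! k"
      using gate by (simp_all add: And cs stores_children_0)
    have st': "arr s 3 (arr s 1 i) = c"
      "\<And>k. k < length cs \<Longrightarrow> arr s 3 (Suc (arr s 1 i + k)) = cs ! k"
      using st(3)[of 0] st(3)[of "Suc _"] by simp_all
    \<comment> \<open>The state after the dispatch: tag, start of the children, and the tag last
      compared with.\<close>
    define s1 where "s1 = set_reg 18 4 (set_reg 16 (arr s 1 i) (set_reg 15 4 s))"
    have "runs (emit_and pol) s1
      (\<lambda>u s'. u \<le> 12 + 6 * length cs \<and> writes_gate d s1 s' \<and> arr s' 8 d = 5 \<and>
        stores_children 8 s' d (node_copy n False c # map (node_copy n pol) cs) \<and>
        arr s' 10 d \<le> reg s' 12)"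
      by (rule runs_emit_and[where x = "arr s 1 i"])
        (use st(1,2) st' regs d cr table[of _ pol] table[of c False] in \<open>auto simp: s1_def And cs\<close>)
    then have "runs (emit_and pol) s1
      (\<lambda>u s'. u \<le> 12 + 6 * length cs \<and> writes_gate d s s' \<and>
        stored s' d (quant_gate n L pol (gates C ! i)))"
      by (rule runs_mono)
        (simp add: stored_def And cs s1_def writes_gate_def)
    then show "runs (emit_gate b pol) s (\<lambda>t s'. t \<le> 40 + 6 * length (children (gates C ! i)) \<and>
      writes_gate d s s' \<and> stored s' d (quant_gate n L pol (gates C ! i)))"
      using st(1) regs by (simp add: emit_gate_def on_tag_def s1_def And cs) (erule runs_mono, simp add: And cs)
  next
    case (Or cs)
    have st: "arr s 0 i = 5" "arr s 2 i = arr s 1 i + length cs"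
      "\<And>k. k < length cs \<Longrightarrow> arr s 3 (arr s 1 i + k) = cs ! k"
      using gate by (simp_all add: Or stores_children_0)
    show "runs (emit_gate b pol) s (\<lambda>t s'. t \<le> 40 + 6 * length (children (gates C ! i)) \<and>
      writes_gate d s s' \<and> stored s' d (quant_gate n L pol (gates C ! i)))"
    proof -
      \<comment> \<open>Register 18 holds 4, as or-gates are handled by the failing branch of the
        last comparison.\<close>
      define s1 where "s1 = set_reg 18 4 (set_reg 16 (arr s 1 i) (set_reg 15 5 s))"
      have "runs (emit_or pol) s1
        (\<lambda>u s'. u \<le> 7 + 6 * length cs \<and> writes_gate d s1 s' \<and> arr s' 8 d = 4 \<and>
          stores_children 8 s' d (map (node_copy n pol) cs) \<and> arr s' 10 d \<le> reg s' 12)"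
        by (rule runs_emit_or[where x = "arr s 1 i"])
          (use st regs d cr table[of _ pol] in \<open>auto simp: s1_def Or\<close>)
      then have "runs (emit_or pol) s1
        (\<lambda>u s'. u \<le> 7 + 6 * length cs \<and> writes_gate d s s' \<and>
          stored s' d (quant_gate n L pol (gates C ! i)))"
        by (rule runs_mono) (simp add: stored_def Or s1_def writes_gate_def)
      then show ?thesis
        using st(1) regs by (simp add: emit_gate_def on_tag_def s1_def Or) (erule runs_mono, simp add: Or)
    qed
  qed
qed

section \<open>The loops and the complete program\<close>

lemma circuit_size_eq_sum: "circuit_size C = (\<Sum>k<length (gates C). Suc (length (children (gates C ! k))))"
  unfolding circuit_size_def
  by (simp only: Suc_eq_plus1 sum.distrib)
    (simp add: sum_list_sum_nth atLeast0LessThan)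

lemma runs_make_tables:
  assumes n: "reg s 0 = n"
  shows "runs make_tables s (\<lambda>t s'. t \<le> 3 + 5 * n \<and> (\<forall>r < 10. reg s' r = reg s r) \<and>
    (\<forall>a < 12. arr s' a = arr s a) \<and> (\<forall>pol. \<forall>j < n. arr s' (copy_table pol) j = node_copy n pol j))"
proof -
  define I where "I k s' \<longleftrightarrow> (\<forall>r < 10. reg s' r = reg s r) \<and> (\<forall>a < 12. arr s' a = arr s a) \<and>
    reg s' 10 = k \<and> reg s' 11 = n + k \<and>
    (\<forall>j < k. arr s' 12 j = j \<and> arr s' 13 j = n + j)" for k s'
  have "runs (While (Less 10 0) (Seq (Write 12 10 10) (Seq (Write 13 10 11) (Seq (Succ 10 10) (Succ 11 11)))))
    (set_reg 11 n (set_reg 10 0 s)) (\<lambda>t s'. t \<le> Suc (\<Sum>k<n. Suc 4) \<and> I n s')"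
    by (rule runs_While)
      (use n in \<open>auto simp: I_def less_Suc_eq\<close>)
  then show ?thesis
    using n by (simp add: make_tables_def)
      (erule runs_mono, auto simp: I_def copy_table_def node_copy_def)
qed

lemma runs_emit_gates:
  assumes ready: "ready b L C s" and b: "b < 7" and n: "n = length (gates C)"
  shows "runs (emit_gates b) s (\<lambda>t s'. t \<le> 4 + 83 * circuit_size C \<and>
    ready b L C s' \<and> reg s' 11 = n + n \<and>
    (\<forall>pol. \<forall>j < n. stored s' (node_copy n pol j) (quant_gate n L pol (gates C ! j))))"
proof -
  define I where "I k s' \<longleftrightarrow> ready b L C s' \<and> reg s' 10 = k \<and> reg s' 11 = n + k \<and>
    (\<forall>pol. \<forall>j < k. stored s' (node_copy n pol j) (quant_gate n L pol (gates C ! j)))" for k s'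
  \<comment> \<open>Two copies and two counter increments. With the loop test this is at most 83
    times the contribution of gate \<open>k\<close> to the circuit size.\<close>
  define c where "c k = 2 * (40 + 6 * length (children (gates C ! k))) + 2" for k
  have reg0: "reg s' 0 = n" if "ready b L C s'" for s'
    using that by (simp add: ready_def stores_circuit_def n)
  have ready_writes: "ready b L C s''" if "ready b L C s'" "writes_gate j s' s''" for j s' s''
    by (rule ready_mono[OF that(1) b]) (use that(2) in \<open>auto simp: writes_gate_def\<close>)
  have "runs (While (Less 10 0)
      (Seq (emit_gate b True) (Seq (emit_gate b False) (Seq (Succ 10 10) (Succ 11 11)))))
    (set_reg 12 0 (set_reg 11 n (set_reg 10 0 s))) (\<lambda>t s'. t \<le> Suc (\<Sum>k<n. Suc (c k)) \<and> I n s')"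
  proof (rule runs_While)
    fix k s1 assume k: "k < n" and I: "I k s1"
    let ?q = "\<lambda>pol. quant_gate n L pol (gates C ! k)"
    have "runs (Seq (emit_gate b True) (Seq (emit_gate b False) (Seq (Succ 10 10) (Succ 11 11)))) s1
      (\<lambda>t s'. t \<le> (40 + 6 * length (children (gates C ! k))) +
        ((40 + 6 * length (children (gates C ! k))) + 2) \<and> I (Suc k) s')"
    proof (rule runs_SeqI, rule runs_emit_gate[OF _ b n k])
      fix s2
      assume s2: "writes_gate (node_copy n True k) s1 s2 \<and> stored s2 (node_copy n True k) (?q True)"
      then have r2: "ready b L C s2" "reg s2 10 = k" "reg s2 11 = n + k"
        using I ready_writes by (auto simp: I_def writes_gate_def)
      show "runs (Seq (emit_gate b False) (Seq (Succ 10 10) (Succ 11 11))) s2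
        (\<lambda>t s'. t \<le> (40 + 6 * length (children (gates C ! k))) + 2 \<and> I (Suc k) s')"
      proof (rule runs_SeqI, rule runs_emit_gate[OF r2(1) b n k r2(2,3)])
        fix s3
        assume s3: "writes_gate (node_copy n False k) s2 s3 \<and> stored s3 (node_copy n False k) (?q False)"
        \<comment> \<open>Emitting the second copy writes at \<open>n + k\<close>, so the first copy
          at \<open>k\<close> survives.\<close>
        have new: "stored s3 (node_copy n pol k) (?q pol)" for pol
          using s2 s3 k by (cases pol) (auto intro: stored_mono simp: node_copy_def)
        have old: "stored s3 (node_copy n pol j) (quant_gate n L pol (gates C ! j))" if "j < k" for pol j
        proof (rule stored_mono, rule stored_mono)
          show "stored s1 (node_copy n pol j) (quant_gate n L pol (gates C ! j))"
            using I that by (simp add: I_def)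
        qed (use s2 s3 that k in \<open>auto simp: node_copy_def\<close>)
        have r3: "ready b L C s3" "reg s3 10 = k" "reg s3 11 = n + k"
          using s3 r2 ready_writes by (auto simp: writes_gate_def)
        let ?s4 = "set_reg 11 (Suc (n + k)) (set_reg 10 (Suc k) s3)"
        have "ready b L C ?s4"
          by (rule ready_mono[OF r3(1) b]) auto
        moreover have "stored ?s4 j g = stored s3 j g" for j g
          by (auto simp: stored_def intro: stores_gate_cong[where s = s3]
              stores_gate_cong[where s = ?s4])
        ultimately show "runs (Seq (Succ 10 10) (Succ 11 11)) s3 (\<lambda>t s'. t \<le> 2 \<and> I (Suc k) s')"
          using new old r3 by (auto simp: I_def less_Suc_eq)
      qed
    qed (use I in \<open>simp_all add: I_def\<close>)
    then show "holds (Less 10 0) s1 \<and>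
      runs (Seq (emit_gate b True) (Seq (emit_gate b False) (Seq (Succ 10 10) (Succ 11 11)))) s1
        (\<lambda>t s'. t \<le> c k \<and> I (Suc k) s')"
      using k I reg0 by (simp add: I_def c_def del: runs_simps(6)) (erule runs_mono, simp add: c_def)
  next
    fix s1 assume "I n s1"
    then show "\<not> holds (Less 10 0) s1" using reg0 by (simp add: I_def)
  next
    show "I 0 (set_reg 12 0 (set_reg 11 n (set_reg 10 0 s)))"
      using ready_mono[OF ready b] by (simp add: I_def)
  qed
  moreover have "Suc (\<Sum>k<n. Suc (c k)) \<le> 1 + 83 * circuit_size C"
  proof -
    have "(\<Sum>k<n. Suc (c k)) \<le> (\<Sum>k<n. 83 * Suc (length (children (gates C ! k))))"
      by (rule sum_mono) (simp add: c_def)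
    then show ?thesis by (simp add: circuit_size_eq_sum n sum_distrib_left)
  qed
  ultimately show ?thesis
    using reg0[OF ready] by (simp add: emit_gates_def) (erule runs_mono, auto simp: I_def)
qed

lemma runs_emit_all_nodes:
  assumes "reg s 11 = N"
  shows "runs emit_all_nodes s (\<lambda>t s'. t \<le> 6 + 4 * N \<and> writes_gate N s s' \<and> stored s' N (Or [0..<N]))"
proof -
  define I where "I k s' \<longleftrightarrow> (\<forall>r < 12. reg s' r = reg s r) \<and> reg s' 12 = reg s 12 + k \<and>
    reg s' 13 = k \<and> (\<forall>a < 8. arr s' a = arr s a) \<and> (\<forall>a > 11. arr s' a = arr s a) \<and>
    arr s' 8 = (arr s 8)(N := 5) \<and> arr s' 9 = (arr s 9)(N := reg s 12) \<and> arr s' 10 = arr s 10 \<and>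
    (\<forall>j < reg s 12. arr s' 11 j = arr s 11 j) \<and> (\<forall>j < k. arr s' 11 (reg s 12 + j) = j)" for k s'
  have "runs (While (Less 13 11) (Seq (Write 11 12 13) (Seq (Succ 12 12) (Succ 13 13))))
    (set_reg 13 0 (set_arr 9 N (reg s 12) (set_arr 8 N 5 (set_reg 17 5 s))))
    (\<lambda>t s'. t \<le> Suc (\<Sum>k<N. Suc 3) \<and> I N s')"
    by (rule runs_While) (use assms in \<open>auto simp: I_def less_Suc_eq\<close>)
  then show ?thesis
    using assms by (simp add: emit_all_nodes_def)
      (erule runs_mono, auto simp: I_def writes_gate_def stored_def stores_children_def)
qed

lemma runs_emit_root:
  assumes "reg s 11 = N"
  shows "runs emit_root s (\<lambda>t s'. t \<le> 9 \<and> reg s' 13 = Suc N \<and> writes_gate (Suc N) s s' \<and>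
    stored s' (Suc N) (And [reg s 1, N]))"
  using assms
  by (auto simp: emit_root_def writes_gate_def stored_def stores_children_def nth_Cons
      split: nat.split)

lemma runs_quantify:
  assumes C: "sdd_circuit C" "stores_circuit 0 s C" "occurring_literal_table b s L C" and b: "b < 7"
  shows "runs (quantify b) s (\<lambda>t s'. t \<le> 200 * circuit_size C \<and>
    stores_circuit 8 s' (quant_circuit L C))"
proof -
  define n where "n = length (gates C)"
  have nnf: "nnf_circuit C" using C(1) by (simp add: sdd_circuit_def)
  have reg: "reg s 0 = n" "reg s 1 = root C"
    using C(2) by (simp_all add: stores_circuit_def n_def)
  have n: "0 < n" "n \<le> circuit_size C"
    using nnf by (auto simp: nnf_circuit_def n_def circuit_size_def)
  have "runs (quantify b) s (\<lambda>t s'. t \<le> (3 + 5 * n) + ((4 + 83 * circuit_size C) +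
    ((6 + 4 * (n + n)) + (9 + 2))) \<and> stores_circuit 8 s' (quant_circuit L C))"
    unfolding quantify_def
  proof (rule runs_SeqI, rule runs_make_tables[OF reg(1)])
    fix s1
    assume s1: "(\<forall>r < 10. reg s1 r = reg s r) \<and> (\<forall>a < 12. arr s1 a = arr s a) \<and>
      (\<forall>pol. \<forall>j < n. arr s1 (copy_table pol) j = node_copy n pol j)"
    have "stores_gate 0 s1 i (gates C ! i)" if "i < n" for i
      by (rule stores_gate_cong[where s = s])
        (use C(2) that s1 in \<open>auto simp: stores_circuit_def n_def\<close>)
    then have ready: "ready b L C s1"
      using C(2,3) s1 nnf b
      by (simp add: ready_def stores_circuit_def n_def occurring_literal_table_def)
    show "runs (Seq (emit_gates b) (Seq emit_all_nodes (Seq emit_root (Seq (Copy 9 13) (Succ 8 13))))) s1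
      (\<lambda>t s'. t \<le> (4 + 83 * circuit_size C) + ((6 + 4 * (n + n)) + (9 + 2)) \<and>
        stores_circuit 8 s' (quant_circuit L C))"
    proof (rule runs_SeqI, rule runs_emit_gates[OF ready b n_def])
      fix s2
      assume s2: "ready b L C s2 \<and> reg s2 11 = n + n \<and>
        (\<forall>pol. \<forall>j < n. stored s2 (node_copy n pol j) (quant_gate n L pol (gates C ! j)))"
      show "runs (Seq emit_all_nodes (Seq emit_root (Seq (Copy 9 13) (Succ 8 13)))) s2
        (\<lambda>t s'. t \<le> (6 + 4 * (n + n)) + (9 + 2) \<and> stores_circuit 8 s' (quant_circuit L C))"
      proof (rule runs_SeqI, rule runs_emit_all_nodes)
        show "reg s2 11 = n + n" using s2 by simp
      next
        fix s3
        assume s3: "writes_gate (n + n) s2 s3 \<and> stored s3 (n + n) (Or [0..<n + n])"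
        show "runs (Seq emit_root (Seq (Copy 9 13) (Succ 8 13))) s3
          (\<lambda>t s'. t \<le> 9 + 2 \<and> stores_circuit 8 s' (quant_circuit L C))"
        proof (rule runs_SeqI, rule runs_emit_root)
          show "reg s3 11 = n + n" using s2 s3 by (simp add: writes_gate_def)
        next
          fix s4
          assume s4: "reg s4 13 = Suc (n + n) \<and> writes_gate (Suc (n + n)) s3 s4 \<and>
            stored s4 (Suc (n + n)) (And [reg s3 1, n + n])"
          have root: "reg s3 1 = root C"
            using s2 s3 by (simp add: ready_def stores_circuit_def writes_gate_def)
          have "stored s4 j (gates (quant_circuit L C) ! j)" if j: "j < Suc (Suc (n + n))" for j
          proof -
            consider "j < n + n" | "j = n + n" | "j = Suc (n + n)" using j by linarith
            then show ?thesis
            proof cases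
              case 1
              then obtain pol i where i: "i < n" "j = node_copy n pol i" by (rule node_copy_cases)
              have "stored s2 j (gates (quant_circuit L C) ! j)"
                using s2 i by (simp add: quant_circuit_copy n_def)
              then show ?thesis using s3 s4 1 stored_mono[of s2 j _ "n + n" s3] stored_mono[of s3 j _ "Suc (n + n)" s4]
                by simp
            next
              case 2
              then show ?thesis
                using s3 s4 quant_circuit_last(1)[OF n_def] stored_mono[of s3 j _ "Suc (n + n)" s4] by simp
            next
              case 3
              then show ?thesis
                using s4 root quant_circuit_last(2)[OF n_def] by simp
            qed
          qed
          moreover have "stores_gate 8 (set_reg 8 x (set_reg 9 y s4)) j g = stores_gate 8 s4 j g"
            for x y j g
            by (auto intro: stores_gate_cong[where s = s4]
                stores_gate_cong[where s = "set_reg 8 x (set_reg 9 y s4)"])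
          ultimately show "runs (Seq (Copy 9 13) (Succ 8 13)) s4
            (\<lambda>t s'. t \<le> 2 \<and> stores_circuit 8 s' (quant_circuit L C))"
            using s4 by (simp add: stores_circuit_def stored_def n_def root_quant_circuit)
        qed
      qed
    qed
  qed
  \<comment> \<open>A circuit has a gate, so its size is positive and absorbs the additive
    constants.\<close>
  then show ?thesis by (rule runs_mono) (use n in auto)
qed

section \<open>Building the literal table from a list\<close>

lemma runs_clear_literals:
  assumes "reg s 0 = n"
  shows "runs clear_literals s (\<lambda>t s'. t \<le> 3 + 5 * n \<and> (\<forall>r < 10. reg s' r = reg s r) \<and>
    (\<forall>a < 6. arr s' a = arr s a) \<and>
    (\<forall>i < n. arr s' 6 (arr s 1 i) = 0 \<and> arr s' 7 (arr s 1 i) = 0))"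
proof -
  define I where "I k s' \<longleftrightarrow> (\<forall>r < 10. reg s' r = reg s r) \<and> reg s' 10 = k \<and> reg s' 17 = 0 \<and>
    (\<forall>a < 6. arr s' a = arr s a) \<and>
    (\<forall>i < k. arr s' 6 (arr s 1 i) = 0 \<and> arr s' 7 (arr s 1 i) = 0)" for k s'
  have "runs (While (Less 10 0) (Seq (Read 16 1 10) (Seq (Write 6 16 17) (Seq (Write 7 16 17) (Succ 10 10)))))
    (set_reg 17 0 (set_reg 10 0 s)) (\<lambda>t s'. t \<le> Suc (\<Sum>k<n. Suc 4) \<and> I n s')"
    by (rule runs_While) (use assms in \<open>auto simp: I_def less_Suc_eq\<close>)
  then show ?thesis
    by (simp add: clear_literals_def) (erule runs_mono, auto simp: I_def)
qed

text \<open>Nothing is claimed about entries that were not zero before: arrays 6 and 7 may hold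
  arbitrary values wherever they were not cleared.\<close>

lemma runs_enter_literals:
  assumes ls: "stores_literal_list 4 s ls"
  shows "runs enter_literals s (\<lambda>t s'. t \<le> 3 + 6 * length ls \<and> (\<forall>r < 10. reg s' r = reg s r) \<and>
    (\<forall>a < 6. arr s' a = arr s a) \<and>
    (\<forall>x. arr s 6 x = 0 \<longrightarrow> arr s' 6 x = (if Pos x \<in> set ls then 1 else 0)) \<and>
    (\<forall>x. arr s 7 x = 0 \<longrightarrow> arr s' 7 x = (if Neg x \<in> set ls then 1 else 0)))"
proof -
  define I where "I k s' \<longleftrightarrow> (\<forall>r < 10. reg s' r = reg s r) \<and> reg s' 10 = k \<and> reg s' 18 = 1 \<and>
    (\<forall>a < 6. arr s' a = arr s a) \<and>
    (\<forall>x. arr s 6 x = 0 \<longrightarrow> arr s' 6 x = (if Pos x \<in> set (take k ls) then 1 else 0)) \<and>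
    (\<forall>x. arr s 7 x = 0 \<longrightarrow> arr s' 7 x = (if Neg x \<in> set (take k ls) then 1 else 0))" for k s'
  have st: "reg s 4 = length ls" "\<And>k. k < length ls \<Longrightarrow> arr s 4 k = var (ls ! k)"
    "\<And>k. k < length ls \<Longrightarrow> arr s 5 k = (if ls ! k = Pos (var (ls ! k)) then 1 else 0)"
    using ls by (simp_all add: stores_literal_list_def)
  have "runs (While (Less 10 4) (Seq (Read 16 4 10) (Seq (Read 15 5 10)
      (Seq (If (Equal 15 18) (Write 6 16 18) (Write 7 16 18)) (Succ 10 10)))))
    (set_reg 18 1 (set_reg 10 0 s)) (\<lambda>t s'. t \<le> Suc (\<Sum>k<length ls. Suc 5) \<and> I (length ls) s')"
  proof (rule runs_While)
    fix k s' assume "k < length ls" "I k s'"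
    then show "holds (Less 10 4) s' \<and> runs (Seq (Read 16 4 10) (Seq (Read 15 5 10)
      (Seq (If (Equal 15 18) (Write 6 16 18) (Write 7 16 18)) (Succ 10 10)))) s'
      (\<lambda>t s'. t \<le> 5 \<and> I (Suc k) s')"
      using st by (cases "ls ! k") (auto simp: I_def take_Suc_conv_app_nth)
  qed (use st(1) in \<open>auto simp: I_def\<close>)
  then show ?thesis
    by (simp add: enter_literals_def) (erule runs_mono, auto simp: I_def)
qed

lemma runs_quantify_list:
  assumes C: "sdd_circuit C" "stores_circuit 0 s C" and ls: "stores_literal_list 4 s ls"
  shows "runs (Seq clear_literals (Seq enter_literals (quantify 6))) s
    (\<lambda>t s'. t \<le> 220 * (circuit_size C + length ls) \<and> stores_circuit 8 s' (quant_circuit (set ls) C))"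
proof -
  define n where "n = length (gates C)"
  have reg: "reg s 0 = n"
    using C(2) by (simp add: stores_circuit_def n_def)
  have n: "0 < n" "n \<le> circuit_size C"
    using C(1) by (auto simp: sdd_circuit_def nnf_circuit_def n_def circuit_size_def)
  have "runs (Seq clear_literals (Seq enter_literals (quantify 6))) s
    (\<lambda>t s'. t \<le> (3 + 5 * n) + ((3 + 6 * length ls) + 200 * circuit_size C) \<and>
      stores_circuit 8 s' (quant_circuit (set ls) C))"
  proof (rule runs_SeqI, rule runs_clear_literals[OF reg])
    fix s1
    assume s1: "(\<forall>r < 10. reg s1 r = reg s r) \<and> (\<forall>a < 6. arr s1 a = arr s a) \<and>
      (\<forall>i < n. arr s1 6 (arr s 1 i) = 0 \<and> arr s1 7 (arr s 1 i) = 0)"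
    show "runs (Seq enter_literals (quantify 6)) s1
      (\<lambda>t s'. t \<le> (3 + 6 * length ls) + 200 * circuit_size C \<and>
        stores_circuit 8 s' (quant_circuit (set ls) C))"
    proof (rule runs_SeqI, rule runs_enter_literals)
      show "stores_literal_list 4 s1 ls"
        using ls s1 by (simp add: stores_literal_list_def)
    next
      fix s2
      assume s2: "(\<forall>r < 10. reg s2 r = reg s1 r) \<and> (\<forall>a < 6. arr s2 a = arr s1 a) \<and>
        (\<forall>x. arr s1 6 x = 0 \<longrightarrow> arr s2 6 x = (if Pos x \<in> set ls then 1 else 0)) \<and>
        (\<forall>x. arr s1 7 x = 0 \<longrightarrow> arr s2 7 x = (if Neg x \<in> set ls then 1 else 0))"
      have "stores_gate 0 s2 i (gates C ! i)" if "i < n" for i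
        by (rule stores_gate_cong[where s = s])
          (use C(2) that s1 s2 in \<open>auto simp: stores_circuit_def n_def\<close>)
      then have "stores_circuit 0 s2 C"
        using C(2) s1 s2 by (simp add: stores_circuit_def n_def)
      moreover have "occurring_literal_table 6 s2 (set ls) C"
        unfolding occurring_literal_table_def
      proof (intro allI impI)
        fix l assume "Lit l \<in> set (gates C)"
        then obtain i where i: "i < n" "gates C ! i = Lit l"
          by (auto simp: in_set_conv_nth n_def)
        then have "stores_gate 0 s i (Lit l)" using C(2) by (metis n_def stores_circuit_def)
        then have "arr s 1 i = var l" by (cases l) auto
        then have zero: "arr s1 6 (var l) = 0" "arr s1 7 (var l) = 0"
          using s1 i(1) by (metis, metis)
        show "arr s2 6 (var l) = (if Pos (var l) \<in> set ls then 1 else 0) \<and>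
          arr s2 (Suc 6) (var l) = (if Neg (var l) \<in> set ls then 1 else 0)"
          using s2 zero by simp
      qed
      ultimately show "runs (quantify 6) s2 (\<lambda>t s'. t \<le> 200 * circuit_size C \<and>
          stores_circuit 8 s' (quant_circuit (set ls) C))"
        using C(1) by (intro runs_quantify) auto
    qed
  qed
  then show ?thesis by (rule runs_mono) (use n in auto)
qed

section \<open>The length of the literal list against the circuit size\<close>

lemma vars_formula_at: "vars (formula_at C i) \<subseteq> {var l |l. Lit l \<in> set (gates C)}"
proof (induction C i rule: formula_at.induct)
  case (1 C i)
  show ?case
  proof (cases "acyclic (edges C) \<and> i < length (gates C)")
    case True
    then have g: "gates C ! i \<in> set (gates C)" by simp
    have eq: "formula_at C i =
        (case gates C ! i of
           Const b \<Rightarrow> FConst b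
         | Lit l \<Rightarrow> FLit l
         | And cs \<Rightarrow> FAnd (map (formula_at C) cs)
         | Or cs \<Rightarrow> FOr (map (formula_at C) cs))"
      using True by (subst formula_at.simps) simp
    show ?thesis
    proof (cases "gates C ! i")
      case (Lit l)
      then show ?thesis using g by (auto simp: eq)
    next
      case (And cs)
      then show ?thesis using 1(1)[OF True And] by (simp add: eq UN_subset_iff)
    next
      case (Or cs)
      then show ?thesis using 1(2)[OF True Or] by (simp add: eq UN_subset_iff)
    qed (simp add: eq)
  next
    case False
    then show ?thesis by (subst formula_at.simps) auto
  qed
qed

lemma card_vars_formula_of: "card (vars (formula_of C)) \<le> circuit_size C"
proof -
  \<comment> \<open>The default 0 may add a spurious variable, which is harmless for an upper
    bound.\<close>
  let ?f = "\<lambda>g. case g of Lit l \<Rightarrow> var l | _ \<Rightarrow> 0"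
  have "{var l |l. Lit l \<in> set (gates C)} \<subseteq> ?f ` set (gates C)"
  proof clarify
    fix l assume "Lit l \<in> set (gates C)"
    then show "var l \<in> ?f ` set (gates C)" by (rule rev_image_eqI) simp
  qed
  with vars_formula_at have "vars (formula_of C) \<subseteq> ?f ` set (gates C)"
    unfolding formula_of_def by (rule subset_trans)
  then have "card (vars (formula_of C)) \<le> card (?f ` set (gates C))"
    by (intro card_mono) simp_all
  also have "\<dots> \<le> card (set (gates C))"
    by (rule card_image_le) simp
  also have "\<dots> \<le> length (gates C)" by (rule card_length)
  finally show ?thesis by (simp add: circuit_size_def)
qed

lemma finite_vars: "finite (vars \<phi>)"
  by (induction \<phi>) auto

text \<open>An occurring variable accounts for at most two literals, and there are no more such
  variables than gates. So reading the list costs only what the size and the foreign literals pay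
  for.\<close>

lemma length_literals_le:
  assumes "distinct ls"
  shows "length ls \<le> 2 * circuit_size C + card {l \<in> set ls. var l \<notin> vars (formula_of C)}"
proof -
  let ?V = "vars (formula_of C)"
  have "set ls \<subseteq> (Pos ` ?V \<union> Neg ` ?V) \<union> {l \<in> set ls. var l \<notin> ?V}"
  proof
    fix l assume l: "l \<in> set ls"
    show "l \<in> (Pos ` ?V \<union> Neg ` ?V) \<union> {l \<in> set ls. var l \<notin> ?V}"
      by (cases l) (use l in auto)
  qed
  then have "card (set ls) \<le> card ((Pos ` ?V \<union> Neg ` ?V) \<union> {l \<in> set ls. var l \<notin> ?V})"
    by (intro card_mono) (simp_all add: finite_vars)
  also have "\<dots> \<le> (card (Pos ` ?V) + card (Neg ` ?V)) + card {l \<in> set ls. var l \<notin> ?V}"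
    by (meson add_le_mono card_Un_le le_refl le_trans)
  also have "\<dots> \<le> 2 * circuit_size C + card {l \<in> set ls. var l \<notin> ?V}"
    using card_image_le[OF finite_vars, of Pos "formula_of C"]
      card_image_le[OF finite_vars, of Neg "formula_of C"] card_vars_formula_of[of C] by linarith
  finally show ?thesis using assms by (simp add: distinct_card)
qed

lemma outputs_forallI:
  assumes "sdd_circuit C" and "runs P s (\<lambda>u s'. u \<le> t \<and> stores_circuit 8 s' (quant_circuit (set ls) C))"
  shows "outputs_forall P s t ls C"
  using assms nnf_quant_circuit[of C] equivalent_quant_circuit[OF assms(1)]
  unfolding outputs_forall_def runs_def sdd_circuit_def by blast

theorem proposition28:
  "(\<exists>P k. \<forall>C ls s.
      sdd_circuit C \<and> stores_circuit 0 s C \<and> stores_literal_table 4 s (set ls) \<longrightarrow>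
      outputs_forall P s (k * circuit_size C) ls C) \<and>
   (\<exists>P k. \<forall>C ls s.
      sdd_circuit C \<and> stores_circuit 0 s C \<and> distinct ls \<and> stores_literal_list 4 s ls \<longrightarrow>
      outputs_forall P s
        (k * (circuit_size C + card {l \<in> set ls. var l \<notin> vars (formula_of C)})) ls C)"
proof (intro conjI exI allI impI; elim conjE)
  fix C ls s
  assume C: "sdd_circuit C" "stores_circuit 0 s C" and "stores_literal_table 4 s (set ls)"
  then have "occurring_literal_table 4 s (set ls) C"
    by (simp add: occurring_literal_table_def stores_literal_table_def)
  then show "outputs_forall (quantify 4) s (200 * circuit_size C) ls C"
    using C by (intro outputs_forallI runs_quantify) auto
next
  fix C ls s
  assume C: "sdd_circuit C" "stores_circuit 0 s C" and "distinct ls" "stores_literal_list 4 s ls"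
  \<comment> \<open>660 is three times 220: the size itself, plus twice the size for the literals of
    occurring variables.\<close>
  show "outputs_forall (Seq clear_literals (Seq enter_literals (quantify 6))) s
    (660 * (circuit_size C + card {l \<in> set ls. var l \<notin> vars (formula_of C)})) ls C"
    by (rule outputs_forallI[OF C(1)], rule runs_mono, rule runs_quantify_list[OF C])
      (use \<open>stores_literal_list 4 s ls\<close> length_literals_le[OF \<open>distinct ls\<close>, of C] in auto)
qed

end
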